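(* There exists an absolute constant $C>0$ such that for every $d\ge1$, every function $f\colon\{0,1\}^d\to\mathbb{R}$ and every coloring $\mathtt{col}\colon\mathcal{S}_f^-\to\{\mathrm{red},\mathrm{blue}\}$, \[ \mathbb{E}_{\boldsymbol{x}\sim\{0,1\}^d}\Big[\sqrt{I^-_{f,\mathrm{red}}(\boldsymbol{x})}\Big]+\mathbb{E}_{\boldsymbol{y}\sim\{0,1\}^d}\Big[\sqrt{I^-_{f,\mathrm{blue}}(\boldsymbol{y})}\Big]\ \ge\ C\cdot\varepsilon(f), \] where $\boldsymbol{x},\boldsymbol{y}$ are uniform on $\{0,1\}^d$.
   Context: The directed $d$-dimensional hypercube has vertex set $\{0,1\}^d$ and edges the ordered pairs $(x,y)$ such that there is a unique $i\in[d]$ with $x_i=0$, $y_i=1$, and $x_j=y_j$ for all $j\neq i$. The partial order is $x\preceq y$ iff $x_i\le y_i$ for all $i$. A function $g$ is monotone if $g(x)\le g(y)$ whenever $x\preceq y$. The distance to monotonicity $\varepsilon(f)$ is the minimum of $\Pr_{\boldsymbol{x}}[f(\boldsymbol{x})\ne g(\boldsymbol{x})]$ over monotone $g\colon\{0,1\}^d\to\mathbb{R}$. An edge $(x,y)$ is violated by $f$ if $f(x)>f(y)$; $\mathcal{S}_f^-$ is the set of violated edges. For a coloring $\mathtt{col}$ of $\mathcal{S}_f^-$: $I^-_{f,\mathrm{red}}(x)=|\{y:(x,y)\in\mathcal{S}_f^-,\ \mathtt{col}(x,y)=\mathrm{red}\}|$ (outgoing red violated edges at $x$) and $I^-_{f,\mathrm{blue}}(y)=|\{x:(x,y)\in\mathcal{S}_f^-,\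 \mathtt{col}(x,y)=\mathrm{blue}\}|$ (incoming blue violated edges at $y$). *)

theory Defs
  imports "HOL-Probability.Probability"
begin

text \<open>
  The dimension is a natural number (it is quantified after the absolute constant), so a point of
  the cube is an extensional function on \<^term>\<open>{1..d}\<close>.  Functions on the cube and colorings of
  its violated edges are represented by total functions; only their values on the cube,
  respectively on the violated edges, are ever used.
\<close>

type_synonym point = "nat \<Rightarrow> nat"

datatype color = Red | Blue

definition hypercube :: "nat \<Rightarrow> point set" where
  "hypercube d = {1..d} \<rightarrow>\<^sub>E {0, 1}"

definition hypercube_edges :: "nat \<Rightarrow> (point \<times> point) set" where
  "hypercube_edges d = {(x, y). x \<in> hypercube d \<and> y \<in> hypercube d \<and>
     (\<exists>!i. i \<in> {1..d} \<and> x i = 0 \<and> y i = 1 \<and> (\<forall>j\<in>{1..d} - {i}. x j = y j))}"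

definition uniform_point :: "nat \<Rightarrow> point pmf" where
  "uniform_point d = pmf_of_set (hypercube d)"

lemma finite_hypercube [simp]: "finite (hypercube d)"
  by (simp add: hypercube_def finite_PiE)

lemma hypercube_nonempty [simp]: "hypercube d \<noteq> {}"
  by (simp add: hypercube_def PiE_eq_empty_iff)

text \<open>
  The library order on functions is pointwise on all of \<^typ>\<open>nat\<close>; points of the cube agree outside
  \<^term>\<open>{1..d}\<close>, so on the cube it is the coordinatewise order.  Hence \<^const>\<open>mono_on\<close> on the
  cube is monotonicity.
\<close>

lemma hypercube_le_iff:
  assumes "x \<in> hypercube d" "y \<in> hypercube d"
  shows "x \<le> y \<longleftrightarrow> (\<forall>i\<in>{1..d}. x i \<le> y i)"
proof
  assume *: "\<forall>i\<in>{1..d}. x i \<le> y i"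
  have "x i \<le> y i" for i
  proof (cases "i \<in> {1..d}")
    case False
    then have "x i = undefined" "y i = undefined"
      using assms unfolding hypercube_def by (blast intro: PiE_arb)+
    then show ?thesis by simp
  qed (use * in blast)
  then show "x \<le> y" by (simp add: le_fun_def)
qed (simp add: le_fun_def)

definition dist_mono :: "nat \<Rightarrow> (point \<Rightarrow> real) \<Rightarrow> real" where
  "dist_mono d f =
     Min {measure_pmf.prob (uniform_point d) {x \<in> hypercube d. f x \<noteq> g x} | g :: point \<Rightarrow> real.
            mono_on (hypercube d) g}"

text \<open>The minimum is over a finite nonempty set of values, so it is attained.\<close>

lemma dist_mono_values:
  fixes d :: nat and f :: "point \<Rightarrow> real"
  defines "V \<equiv> {measure_pmf.prob (uniform_point d) {x \<in> hypercube d. f x \<noteq> g x} | g :: point \<Rightarrow> real.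
                   mono_on (hypercube d) g}"
  shows "finite V" "V \<noteq> {}"
proof -
  have "V \<subseteq> measure_pmf.prob (uniform_point d) ` Pow (hypercube d)"
    unfolding V_def by auto
  then show "finite V"
    by (rule finite_subset) simp
  have "mono_on (hypercube d) (\<lambda>_. 0 :: real)"
    by (simp add: monotone_on_def)
  then show "V \<noteq> {}"
    unfolding V_def by blast
qed

definition violated_edges :: "nat \<Rightarrow> (point \<Rightarrow> real) \<Rightarrow> (point \<times> point) set" where
  "violated_edges d f = {(x, y) \<in> hypercube_edges d. f x > f y}"

definition I_red :: "nat \<Rightarrow> (point \<Rightarrow> real) \<Rightarrow> (point \<times> point \<Rightarrow> color) \<Rightarrow> point \<Rightarrow> nat" where
  "I_red d f col x = card {y. (x, y) \<in> violated_edges d f \<and> col (x, y) = Red}"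

definition I_blue :: "nat \<Rightarrow> (point \<Rightarrow> real) \<Rightarrow> (point \<times> point \<Rightarrow> color) \<Rightarrow> point \<Rightarrow> nat" where
  "I_blue d f col y = card {x. (x, y) \<in> violated_edges d f \<and> col (x, y) = Blue}"

end

theory Submission
  imports Defs
begin

text \<open>
  For Boolean \<open>f\<close>, fix \<open>x\<close>, an order of the directions and a set \<open>R\<close> of directions, and let \<open>S \<subseteq> R\<close>
  vary: the value at \<open>x\<close> after sorting \<open>f\<close> along \<open>S\<close> is a Boolean function of \<open>S\<close>.  Violated edges, charged
  to one endpoint as the coloring prescribes, can be carried along as labels so that every sensitive
  edge of this tracker is charged and the average of the square root of the number of labels does not
  increase.  Talagrand's (undirected) inequality then shows that sorting along \<open>S\<close> and along \<open>R - S\<close>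
  give nearly the same function.  Passing to random subsets of density \<open>2\<^sup>-\<^sup>k\<close> multiplies the
  functional by at most \<open>(3/4)\<^sup>k\<close>, so the errors form a geometric series and \<open>f\<close> is close to its
  complete, hence monotone, sorting; the order of sorting has to be random too.  For real-valued \<open>f\<close>, a
  matching of maximal weight and minimal size splits into clusters whose sweeping sets are disjoint,
  and on each of them \<open>f\<close> is replaced by a threshold function.
\<close>

section \<open>Averages over the cube and a robust Talagrand inequality\<close>

text \<open>Points of the cube are encoded as subsets of \<open>D\<close>, so the same average
  serves for a uniform point \<open>X\<close> and for a uniform set of directions \<open>A\<close>
  or \<open>S\<close>.\<close>

definition cube_avg :: "'a set \<Rightarrow> ('a set \<Rightarrow> real) \<Rightarrow> real" where
  "cube_avg D h = (\<Sum>X\<in>Pow D. h X) / 2 ^ card D"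

lemma cube_avg_add: "cube_avg D (\<lambda>X. h X + k X) = cube_avg D h + cube_avg D k"
  by (simp add: cube_avg_def sum.distrib add_divide_distrib)

lemma cube_avg_mult: "cube_avg D (\<lambda>X. c * h X) = c * cube_avg D h"
  by (simp add: cube_avg_def sum_distrib_left)

lemma cube_avg_sum: "cube_avg D (\<lambda>X. \<Sum>i\<in>I. h i X) = (\<Sum>i\<in>I. cube_avg D (h i))"
  unfolding cube_avg_def by (subst sum.swap) (simp add: sum_divide_distrib)

lemma cube_avg_const: "finite D \<Longrightarrow> cube_avg D (\<lambda>X. c) = c"
  by (simp add: cube_avg_def card_Pow)

lemma cube_avg_mono:
  "(\<And>X. X \<subseteq> D \<Longrightarrow> h X \<le> k X) \<Longrightarrow> cube_avg D h \<le> cube_avg D k"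
  unfolding cube_avg_def by (intro divide_right_mono sum_mono) auto

lemma cube_avg_cong:
  "(\<And>X. X \<subseteq> D \<Longrightarrow> h X = k X) \<Longrightarrow> cube_avg D h = cube_avg D k"
  unfolding cube_avg_def by (intro arg_cong2[where f = "(/)"] sum.cong) auto

lemma cube_avg_nonneg: "(\<And>X. X \<subseteq> D \<Longrightarrow> 0 \<le> h X) \<Longrightarrow> 0 \<le> cube_avg D h"
  unfolding cube_avg_def by (intro divide_nonneg_nonneg sum_nonneg) auto

lemma cube_avg_swap:
  "cube_avg D (\<lambda>X. cube_avg E (\<lambda>Y. h X Y)) = cube_avg E (\<lambda>Y. cube_avg D (\<lambda>X. h X Y))"
  unfolding cube_avg_def
  by (simp add: sum_divide_distrib[symmetric]) (subst sum.swap, simp add: mult.commute)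

lemma cube_avg_compl: "cube_avg D (\<lambda>X. h (D - X)) = cube_avg D h"
proof -
  have "(\<Sum>X\<in>Pow D. h (D - X)) = (\<Sum>X\<in>Pow D. h X)"
    by (rule sum.reindex_bij_witness[of _ "\<lambda>X. D - X" "\<lambda>X. D - X"]) auto
  then show ?thesis by (simp add: cube_avg_def)
qed

lemma cube_avg_insert:
  assumes "finite D" "a \<notin> D"
  shows "cube_avg (insert a D) h = (cube_avg D h + cube_avg D (\<lambda>X. h (insert a X))) / 2"
proof -
  have inj: "inj_on (insert a) (Pow D)"
    using assms by (auto simp: inj_on_def)
  have "(\<Sum>X\<in>Pow (insert a D). h X) = (\<Sum>X\<in>Pow D. h X) + (\<Sum>X\<in>insert a ` Pow D. h X)"
    unfolding Pow_insert using assms by (intro sum.union_disjoint) auto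
  also have "(\<Sum>X\<in>insert a ` Pow D. h X) = (\<Sum>X\<in>Pow D. h (insert a X))"
    by (simp add: sum.reindex[OF inj])
  finally show ?thesis
    using assms by (simp add: cube_avg_def field_simps)
qed

lemma cube_avg_split:
  assumes "finite D" "a \<in> D"
  shows "cube_avg D h = cube_avg (D - {a}) (\<lambda>X. (h X + h (insert a X)) / 2)"
proof -
  have "cube_avg D h = cube_avg (insert a (D - {a})) h"
    using assms by (simp add: insert_absorb)
  also have "\<dots> = (cube_avg (D - {a}) h + cube_avg (D - {a}) (\<lambda>X. h (insert a X))) / 2"
    using assms by (intro cube_avg_insert) auto
  also have "\<dots> = cube_avg (D - {a}) (\<lambda>X. (h X + h (insert a X)) / 2)"
    using cube_avg_mult[of "D - {a}" "1/2" "\<lambda>X. h X + h (insert a X)"]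
    by (simp add: cube_avg_add)
  finally show ?thesis .
qed

text \<open>The triangle inequality for the complex-valued function with real part \<open>u\<close>
  and imaginary part \<open>v\<close>: the modulus of the average is at most the average of the
  modulus.\<close>

lemma cube_avg_sqrt_sum_squares:
  fixes u v :: "'a set \<Rightarrow> real"
  shows "sqrt ((cube_avg D u)\<^sup>2 + (cube_avg D v)\<^sup>2) \<le> cube_avg D (\<lambda>X. sqrt ((u X)\<^sup>2 + (v X)\<^sup>2))"
proof -
  have "sqrt ((cube_avg D u)\<^sup>2 + (cube_avg D v)\<^sup>2)
      = sqrt ((\<Sum>X\<in>Pow D. u X)\<^sup>2 + (\<Sum>X\<in>Pow D. v X)\<^sup>2) / 2 ^ card D"
    by (simp add: cube_avg_def power_divide real_sqrt_divide flip: add_divide_distrib)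
  also have "sqrt ((\<Sum>X\<in>Pow D. u X)\<^sup>2 + (\<Sum>X\<in>Pow D. v X)\<^sup>2)
      = cmod (\<Sum>X\<in>Pow D. Complex (u X) (v X))"
    by (simp add: cmod_def Re_sum Im_sum)
  also have "\<dots> / 2 ^ card D \<le> (\<Sum>X\<in>Pow D. cmod (Complex (u X) (v X))) / 2 ^ card D"
    by (intro divide_right_mono norm_sum) auto
  finally show ?thesis by (simp add: cube_avg_def cmod_def)
qed

section \<open>The charged Talagrand inequality\<close>

text \<open>Since p(1-p)/2 is at most 1/8, the square of the left side exceeds that of p(1-p)/2 by
  at most r^2. In the induction \<open>r\<close> is the measure of the points charged in the new
  direction, and r^2/2 is the gain it yields.\<close>

lemma sqrt_sum_squares_gain:
  fixes p J r :: real
  assumes p: "0 \<le> p" "p \<le> 1" and J: "p * (1 - p) / 2 \<le> J" and r: "0 \<le> r" "r \<le> 1"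
  shows "p * (1 - p) / 2 + r\<^sup>2 / 2 \<le> sqrt (J\<^sup>2 + r\<^sup>2)"
proof -
  define q where "q = p * (1 - p) / 2"
  have q0: "0 \<le> q" using p by (simp add: q_def)
  have "0 \<le> (p - 1/2)\<^sup>2" by simp
  then have q1: "q \<le> 1/8"
    unfolding q_def by (simp add: power2_eq_square algebra_simps)
  have r2: "r\<^sup>2 \<le> 1" using r by (simp add: power_le_one)
  have "(q + r\<^sup>2 / 2)\<^sup>2 = q\<^sup>2 + r\<^sup>2 * (q + r\<^sup>2 / 4)"
    by (simp add: power2_eq_square algebra_simps)
  also have "\<dots> \<le> q\<^sup>2 + r\<^sup>2 * 1"
    using q1 r2 by (intro add_left_mono mult_left_mono) auto
  also have "\<dots> \<le> J\<^sup>2 + r\<^sup>2"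
    using q0 J by (simp add: q_def power_mono)
  finally show ?thesis
    unfolding q_def using real_le_rsqrt by blast
qed

text \<open>Membership of one direction is split off as a second coordinate, the form to which
  \<open>cube_avg_sqrt_sum_squares\<close> applies.\<close>

lemma sqrt_card_split:
  assumes "finite A"
  shows "sqrt (real (card A)) = sqrt ((sqrt (real (card (A - {a}))))\<^sup>2 + (of_bool (a \<in> A))\<^sup>2)"
proof (cases "a \<in> A")
  case True
  then show ?thesis using assms card.remove[of A a] by simp
qed (use assms in simp)

text \<open>
  Talagrand's inequality in a robust form: every sensitive edge may be charged to either of its
  endpoints.  The two-point inequality survives an arbitrary split of the new direction because
  the gain is quadratic in the charged measure.
\<close>

theorem talagrand_charged:
  fixes g :: "'a set \<Rightarrow> bool" and N :: "'a set \<Rightarrow> 'a set"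
  assumes "finite D"
    and "\<And>S. S \<subseteq> D \<Longrightarrow> finite (N S)"
    and "\<And>S i. S \<subseteq> D \<Longrightarrow> i \<in> D - S \<Longrightarrow> g S \<noteq> g (insert i S) \<Longrightarrow> i \<in> N S \<union> N (insert i S)"
  defines "p \<equiv> cube_avg D (\<lambda>S. of_bool (g S))"
  shows "p * (1 - p) / 2 \<le> cube_avg D (\<lambda>S. sqrt (real (card (N S))))"
  using assms(1-3) unfolding p_def
proof (induction D arbitrary: g N rule: finite_induct)
  case empty
  then show ?case by (cases "g {}") (auto simp: cube_avg_def)
next
  case (insert a D)
  define g1 where "g1 = (\<lambda>S. g (insert a S))"
  define N1 where "N1 = (\<lambda>S. N (insert a S))"
  define p0 where "p0 = cube_avg D (\<lambda>S. of_bool (g S))"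
  define p1 where "p1 = cube_avg D (\<lambda>S. of_bool (g1 S))"
  define J0 where "J0 = cube_avg D (\<lambda>S. sqrt (real (card (N S - {a}))))"
  define J1 where "J1 = cube_avg D (\<lambda>S. sqrt (real (card (N1 S - {a}))))"
  define r where "r = cube_avg D (\<lambda>S. of_bool (a \<in> N S))"
  define s where "s = cube_avg D (\<lambda>S. of_bool (a \<in> N1 S))"
  have bound: "0 \<le> cube_avg D (\<lambda>S. of_bool (P S))" "cube_avg D (\<lambda>S. of_bool (P S)) \<le> 1" for P
  proof -
    show "0 \<le> cube_avg D (\<lambda>S. of_bool (P S))"
      by (intro cube_avg_nonneg) auto
    have "cube_avg D (\<lambda>S. of_bool (P S)) \<le> cube_avg D (\<lambda>S. 1)"
      by (intro cube_avg_mono) auto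
    then show "cube_avg D (\<lambda>S. of_bool (P S)) \<le> 1"
      using insert.hyps by (simp add: cube_avg_const)
  qed
  have fin: "finite (N S)" "finite (N1 S)" if "S \<subseteq> D" for S
    using insert.prems(1)[of S] insert.prems(1)[of "insert a S"] that by (auto simp: N1_def)
  have "i \<in> (N S - {a}) \<union> (N (insert i S) - {a})"
    if "S \<subseteq> D" "i \<in> D - S" "g S \<noteq> g (insert i S)" for S i
    using insert.prems(2)[of S i] that insert.hyps by auto
  then have J0: "p0 * (1 - p0) / 2 \<le> J0"
    unfolding p0_def J0_def using fin by (intro insert.IH) auto
  have "i \<in> (N1 S - {a}) \<union> (N1 (insert i S) - {a})"
    if "S \<subseteq> D" "i \<in> D - S" "g1 S \<noteq> g1 (insert i S)" for S i
    using insert.prems(2)[of "insert a S" i] that insert.hyps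
    by (auto simp: N1_def g1_def insert_commute)
  then have J1: "p1 * (1 - p1) / 2 \<le> J1"
    unfolding p1_def J1_def using fin by (intro insert.IH) auto
  \<comment> \<open>Where the two facets disagree there is a sensitive edge in direction
    \<open>a\<close>, charged in one facet or the other; hence \<open>p0\<close> and
    \<open>p1\<close> differ by at most \<open>r + s\<close>.\<close>
  have "of_bool (g S) \<le> of_bool (g1 S) + (of_bool (a \<in> N S) + of_bool (a \<in> N1 S) :: real)"
    "of_bool (g1 S) \<le> of_bool (g S) + (of_bool (a \<in> N S) + of_bool (a \<in> N1 S) :: real)"
    if "S \<subseteq> D" for S
    using insert.prems(2)[of S a] that insert.hyps by (auto simp: g1_def N1_def)
  then have "p0 \<le> p1 + (r + s)" "p1 \<le> p0 + (r + s)"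
    unfolding p0_def p1_def r_def s_def cube_avg_add[symmetric] by (intro cube_avg_mono; simp)+
  then have rs: "(p0 - p1)\<^sup>2 \<le> (r + s)\<^sup>2"
    by (intro abs_le_square_iff[THEN iffD1]) linarith
  have "sqrt (J0\<^sup>2 + r\<^sup>2) \<le> cube_avg D (\<lambda>S. sqrt (real (card (N S))))"
  proof -
    have "sqrt (J0\<^sup>2 + r\<^sup>2) \<le> cube_avg D (\<lambda>S. sqrt ((sqrt (real (card (N S - {a}))))\<^sup>2 + (of_bool (a \<in> N S))\<^sup>2))"
      unfolding J0_def r_def by (rule cube_avg_sqrt_sum_squares)
    also have "\<dots> = cube_avg D (\<lambda>S. sqrt (real (card (N S))))"
      using fin by (intro cube_avg_cong sqrt_card_split[symmetric]) auto
    finally show ?thesis .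
  qed
  moreover have "sqrt (J1\<^sup>2 + s\<^sup>2) \<le> cube_avg D (\<lambda>S. sqrt (real (card (N1 S))))"
  proof -
    have "sqrt (J1\<^sup>2 + s\<^sup>2) \<le> cube_avg D (\<lambda>S. sqrt ((sqrt (real (card (N1 S - {a}))))\<^sup>2 + (of_bool (a \<in> N1 S))\<^sup>2))"
      unfolding J1_def s_def by (rule cube_avg_sqrt_sum_squares)
    also have "\<dots> = cube_avg D (\<lambda>S. sqrt (real (card (N1 S))))"
      using fin by (intro cube_avg_cong sqrt_card_split[symmetric]) auto
    finally show ?thesis .
  qed
  moreover have "p0 * (1 - p0) / 2 + r\<^sup>2 / 2 \<le> sqrt (J0\<^sup>2 + r\<^sup>2)"
    using J0 bound by (intro sqrt_sum_squares_gain) (auto simp: p0_def r_def)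
  moreover have "p1 * (1 - p1) / 2 + s\<^sup>2 / 2 \<le> sqrt (J1\<^sup>2 + s\<^sup>2)"
    using J1 bound by (intro sqrt_sum_squares_gain) (auto simp: p1_def s_def)
  moreover have "cube_avg (insert a D) (\<lambda>S. sqrt (real (card (N S))))
      = (cube_avg D (\<lambda>S. sqrt (real (card (N S)))) + cube_avg D (\<lambda>S. sqrt (real (card (N1 S))))) / 2"
    using insert.hyps by (simp add: cube_avg_insert N1_def)
  ultimately have le: "(p0 * (1 - p0) / 2 + r\<^sup>2 / 2 + (p1 * (1 - p1) / 2 + s\<^sup>2 / 2)) / 2
      \<le> cube_avg (insert a D) (\<lambda>S. sqrt (real (card (N S))))"
    by (smt (verit) divide_right_mono)
  \<comment> \<open>This gives (r+s)^2 <= 2(r^2+s^2), so the two gains pay for the concavity defect: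
    the value of p(1-p) at the mean of \<open>p0\<close> and \<open>p1\<close> exceeds the mean of
    its values by (p0-p1)^2/4.\<close>
  have "0 \<le> (r - s)\<^sup>2" by simp
  then have "(p0 - p1)\<^sup>2 \<le> 2 * (r\<^sup>2 + s\<^sup>2)"
    using rs by (simp add: power2_eq_square algebra_simps)
  then have "((p0 + p1) / 2) * (1 - (p0 + p1) / 2) / 2
      \<le> (p0 * (1 - p0) / 2 + r\<^sup>2 / 2 + (p1 * (1 - p1) / 2 + s\<^sup>2 / 2)) / 2"
    by (simp add: power2_eq_square field_simps)
  also note le
  finally show ?case
    using insert.hyps by (simp add: cube_avg_insert[of D a "\<lambda>S. of_bool (g S)"] p0_def p1_def g1_def)
qed

section \<open>Sorting operators and labels\<close>

text \<open>Disjunction and conjunction are the maximum and the minimum of the two values on a line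
  in direction \<open>i\<close>; the maximum goes to the upper end.\<close>

definition sort_dir :: "'a \<Rightarrow> ('a set \<Rightarrow> bool) \<Rightarrow> 'a set \<Rightarrow> bool" where
  "sort_dir i F X = (if i \<in> X then F (X - {i}) \<or> F X else F X \<and> F (insert i X))"

text \<open>
  Each point carries a set of directions.  When \<^term>\<open>sort_dir i F\<close> exchanges two values, they take
  their labels along; otherwise labels are pushed towards the end of the line that would be
  the one violating an edge after sorting: downwards between two ones, upwards between two zeros.
\<close>

definition sort_label :: "'a \<Rightarrow> ('a set \<Rightarrow> bool) \<Rightarrow> ('a set \<Rightarrow> 'a set) \<Rightarrow> 'a set \<Rightarrow> 'a set" where
  "sort_label i F N X =
     (let lo = X - {i}; hi = insert i X in
      if F lo \<and> \<not> F hi then N (if i \<in> X then lo else hi)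
      else if \<not> F lo \<and> F hi then N X
      else if F lo = (i \<in> X) then N lo \<inter> N hi else N lo \<union> N hi)"

fun sort_list :: "'a list \<Rightarrow> ('a set \<Rightarrow> bool) \<times> ('a set \<Rightarrow> 'a set) \<Rightarrow> ('a set \<Rightarrow> bool) \<times> ('a set \<Rightarrow> 'a set)" where
  "sort_list [] P = P"
| "sort_list (i # L) P = sort_list L (sort_dir i (fst P), sort_label i (fst P) (snd P))"

definition sort_fun :: "'a list \<Rightarrow> ('a set \<Rightarrow> bool) \<Rightarrow> 'a set \<Rightarrow> bool" where
  "sort_fun L F = fold sort_dir L F"

lemma fst_sort_list: "fst (sort_list L P) = sort_fun L (fst P)"
  by (induction L P rule: sort_list.induct) (auto simp: sort_fun_def)

lemma sort_list_append: "sort_list (L @ K) P = sort_list K (sort_list L P)"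
  by (induction L P rule: sort_list.induct) auto

lemma sort_fun_append: "sort_fun (L @ K) F = sort_fun K (sort_fun L F)"
  by (simp add: sort_fun_def)

section \<open>Directions already sorted\<close>

definition sorted_dir :: "'a \<Rightarrow> ('a set \<Rightarrow> bool) \<Rightarrow> bool" where
  "sorted_dir i F \<longleftrightarrow> (\<forall>X. F X \<longrightarrow> F (insert i X))"

lemma sorted_dir_sort_dir: "sorted_dir i (sort_dir i F)"
  by (auto simp: sorted_dir_def sort_dir_def insert_absorb)

text \<open>Maxima and minima of functions that are monotone in direction \<open>j\<close> are again
  monotone in that direction. So later sortings never undo earlier ones, and a pass through all
  directions gives a monotone function.\<close>

lemma sorted_dir_preserved:
  assumes "sorted_dir j F"
  shows "sorted_dir j (sort_dir i F)"
proof (cases "i = j")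
  case True
  then show ?thesis by (simp add: sorted_dir_sort_dir)
next
  case False
  then have "insert j X - {i} = insert j (X - {i})" for X by auto
  with assms False show ?thesis
    by (auto simp: sorted_dir_def sort_dir_def insert_commute)
qed

lemma sort_dir_id: "sorted_dir i F \<Longrightarrow> sort_dir i F = F"
proof
  fix X assume F: "sorted_dir i F"
  then have "F (X - {i}) \<Longrightarrow> F (insert i X)" "F X \<Longrightarrow> F (insert i X)"
    unfolding sorted_dir_def by (metis insert_Diff_single)+
  then show "sort_dir i F X = F X" by (auto simp: sort_dir_def insert_absorb)
qed

lemma sorted_dir_sort_fun: "i \<in> set L \<or> sorted_dir i F \<Longrightarrow> sorted_dir i (sort_fun L F)"
  unfolding sort_fun_def
  by (induction L arbitrary: F) (auto simp: sorted_dir_sort_dir sorted_dir_preserved)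

lemma sort_fun_id: "(\<And>i. i \<in> set L \<Longrightarrow> sorted_dir i F) \<Longrightarrow> sort_fun L F = F"
  unfolding sort_fun_def by (induction L arbitrary: F) (auto simp: sort_dir_id)

lemma sort_fun_idem: "sort_fun L (sort_fun L F) = sort_fun L F"
  by (intro sort_fun_id sorted_dir_sort_fun) auto

section \<open>Hamming distance and its contraction under sorting\<close>

definition cube_dist :: "'a set \<Rightarrow> ('a set \<Rightarrow> bool) \<Rightarrow> ('a set \<Rightarrow> bool) \<Rightarrow> real" where
  "cube_dist D F G = cube_avg D (\<lambda>X. of_bool (F X \<noteq> G X))"

lemma cube_dist_triangle: "cube_dist D F H \<le> cube_dist D F G + cube_dist D G H"
  unfolding cube_dist_def cube_avg_add[symmetric] by (intro cube_avg_mono) auto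

lemma cube_dist_sym: "cube_dist D F G = cube_dist D G F"
  unfolding cube_dist_def by (intro cube_avg_cong) auto

lemma cube_dist_le_1: "finite D \<Longrightarrow> cube_dist D F G \<le> 1"
  unfolding cube_dist_def using cube_avg_mono[of D "\<lambda>X. of_bool (F X \<noteq> G X)" "\<lambda>_. 1"]
  by (simp add: cube_avg_const)

text \<open>On a line, the sorted pair depends only on the number of ones. Two sorted pairs differ
  in exactly as many places as these numbers differ, which is at most the number of disagreements
  before sorting.\<close>

lemma cube_dist_sort_dir:
  assumes "finite D" "i \<in> D"
  shows "cube_dist D (sort_dir i F) (sort_dir i G) \<le> cube_dist D F G"
  unfolding cube_dist_def cube_avg_split[OF assms]
proof (rule cube_avg_mono)
  fix X assume "X \<subseteq> D - {i}"
  then have X: "i \<notin> X" "insert i X - {i} = X" by auto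
  show "(of_bool (sort_dir i F X \<noteq> sort_dir i G X)
          + of_bool (sort_dir i F (insert i X) \<noteq> sort_dir i G (insert i X))) / (2::real)
      \<le> (of_bool (F X \<noteq> G X) + of_bool (F (insert i X) \<noteq> G (insert i X))) / 2"
    using X by (auto simp: sort_dir_def)
qed

lemma cube_dist_sort_fun:
  assumes "finite D" "set L \<subseteq> D"
  shows "cube_dist D (sort_fun L F) (sort_fun L G) \<le> cube_dist D F G"
  using assms(2)
proof (induction L arbitrary: F G)
  case (Cons i L)
  have "cube_dist D (sort_fun (i # L) F) (sort_fun (i # L) G)
      = cube_dist D (sort_fun L (sort_dir i F)) (sort_fun L (sort_dir i G))"
    by (simp add: sort_fun_def)
  also have "\<dots> \<le> cube_dist D (sort_dir i F) (sort_dir i G)"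
    using Cons by simp
  also have "\<dots> \<le> cube_dist D F G"
    using Cons assms by (intro cube_dist_sort_dir) auto
  finally show ?case .
qed (simp add: sort_fun_def)

text \<open>Union and intersection have the same total size as \<open>A\<close> and \<open>B\<close>
  but lie further apart, so this is concavity of the square root; concretely, the product of the two
  sizes does not increase.\<close>

lemma sqrt_card_Un_Int_le:
  assumes "finite A" "finite B"
  shows "sqrt (real (card (A \<union> B))) + sqrt (real (card (A \<inter> B)))
       \<le> sqrt (real (card A)) + sqrt (real (card B))"
proof -
  define a b u v where "a = real (card A)" and "b = real (card B)"
    and "u = real (card (A \<union> B))" and "v = real (card (A \<inter> B))"
  have sum: "u + v = a + b"
    using card_Un_Int[OF assms] by (simp add: a_def b_def u_def v_def)
  have v: "0 \<le> v" "v \<le> a" "v \<le> b"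
    using assms by (auto simp: v_def a_def b_def intro: card_mono)
  have u: "u = a + b - v" using sum by simp
  have "a * b - u * v = (a - v) * (b - v)"
    unfolding u by (simp add: algebra_simps)
  moreover have "0 \<le> (a - v) * (b - v)" using v by simp
  ultimately have "u * v \<le> a * b" by linarith
  then have "sqrt u * sqrt v \<le> sqrt a * sqrt b"
    by (metis real_sqrt_le_mono real_sqrt_mult)
  moreover have "0 \<le> u" "0 \<le> a" "0 \<le> b" by (auto simp: u_def a_def b_def)
  ultimately have "(sqrt u + sqrt v)\<^sup>2 \<le> (sqrt a + sqrt b)\<^sup>2"
    using sum v by (simp add: power2_sum)
  then show ?thesis
    unfolding a_def b_def u_def v_def by (rule power2_le_imp_le) simp
qed

lemma sort_label_subset:
  assumes "\<And>X. N X \<subseteq> D" shows "sort_label i F N X \<subseteq> D"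
  using assms by (simp add: sort_label_def Let_def) blast

text \<open>On each line the two labels are kept, exchanged, or replaced by their union at one end
  and their intersection at the other; only the last case can change the sum.\<close>

lemma cube_avg_sort_label:
  assumes "finite D" "i \<in> D" "\<And>X. N X \<subseteq> D"
  shows "cube_avg D (\<lambda>X. sqrt (real (card (sort_label i F N X)))) \<le> cube_avg D (\<lambda>X. sqrt (real (card (N X))))"
  unfolding cube_avg_split[OF assms(1,2)]
proof (rule cube_avg_mono)
  fix X assume "X \<subseteq> D - {i}"
  then have X: "i \<notin> X" "insert i X - {i} = X" "X - {i} = X" by auto
  have fin: "finite (N Y)" for Y using assms by (meson finite_subset)
  show "(sqrt (real (card (sort_label i F N X))) + sqrt (real (card (sort_label i F N (insert i X))))) / 2
      \<le> (sqrt (real (card (N X))) + sqrt (real (card (N (insert i X))))) / 2"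
    using X sqrt_card_Un_Int_le[OF fin fin, of X "insert i X"]
    by (auto simp: sort_label_def Let_def)
qed

lemma cube_avg_sort_list:
  assumes "finite D" "set L \<subseteq> D" "\<And>X. snd P X \<subseteq> D"
  shows "(\<forall>X. snd (sort_list L P) X \<subseteq> D) \<and>
    cube_avg D (\<lambda>X. sqrt (real (card (snd (sort_list L P) X)))) \<le> cube_avg D (\<lambda>X. sqrt (real (card (snd P X))))"
  using assms(2,3)
proof (induction L P rule: sort_list.induct)
  case (2 i L P)
  define Q where "Q = (sort_dir i (fst P), sort_label i (fst P) (snd P))"
  have Q: "snd Q X \<subseteq> D" for X
    using 2 by (simp add: Q_def sort_label_subset)
  have "cube_avg D (\<lambda>X. sqrt (real (card (snd Q X)))) \<le> cube_avg D (\<lambda>X. sqrt (real (card (snd P X))))"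
    unfolding Q_def snd_conv using 2 assms(1) by (intro cube_avg_sort_label) auto
  with 2 Q show ?case by (fastforce simp: Q_def[symmetric])
qed auto

section \<open>Charging sensitive edges to labels\<close>

text \<open>Only a fall from \<open>P\<close> to \<open>Q\<close> has to be paid for. This is used
  with \<open>P\<close> and \<open>Q\<close> as the two facets orthogonal to \<open>i\<close>, and,
  in both orders, as the states before and after sorting along \<open>i\<close>.\<close>

definition charged :: "'a \<Rightarrow> ('a set \<Rightarrow> bool) \<times> ('a set \<Rightarrow> 'a set) \<Rightarrow> ('a set \<Rightarrow> bool) \<times> ('a set \<Rightarrow> 'a set) \<Rightarrow> 'a set \<Rightarrow> bool" where
  "charged i P Q X \<longleftrightarrow> (fst P X \<longrightarrow> \<not> fst Q X \<longrightarrow> i \<in> snd P X \<union> snd Q X)"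

text \<open>A fall at the upper end after sorting needs \<open>G\<close> to vanish at both ends, and
  then the labels of \<open>G\<close> are united there. If \<open>F\<close> has two ones, both ends
  fell before, so the intersection of its labels suffices; if it has one, its label travels along.
  The lower end is dual.\<close>

lemma charged_sort:
  assumes "charged i (F, N) (G, M) (X - {k})" "charged i (F, N) (G, M) (insert k X)"
  shows "charged i (sort_dir k F, sort_label k F N) (sort_dir k G, sort_label k G M) X"
proof (cases "k \<in> X")
  case True
  then have "insert k X = X" by auto
  with True assms show ?thesis
    unfolding charged_def sort_dir_def sort_label_def Let_def
    by (cases "F X"; cases "F (X - {k})"; cases "G X"; cases "G (X - {k})") auto
next
  case False
  then have "X - {k} = X" by auto
  with False assms show ?thesis
    unfolding charged_def sort_dir_def sort_label_def Let_def
    by (cases "F X"; cases "F (insert k X)"; cases "G X"; cases "G (insert k X)") auto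
qed

lemma charged_sort_list:
  assumes "\<And>X. charged i P Q X"
  shows "charged i (sort_list L P) (sort_list L Q) X"
  using assms
proof (induction L arbitrary: P Q)
  case (Cons k L)
  show ?case
    using Cons.prems by (simp, intro Cons.IH charged_sort) auto
qed simp

definition covers :: "'a \<Rightarrow> ('a set \<Rightarrow> bool) \<times> ('a set \<Rightarrow> 'a set) \<Rightarrow> bool" where
  "covers i P \<longleftrightarrow> (\<forall>X. i \<notin> X \<longrightarrow> fst P X \<longrightarrow> \<not> fst P (insert i X) \<longrightarrow> i \<in> snd P X \<union> snd P (insert i X))"

text \<open>Sorting in direction \<^term>\<open>k \<noteq> i\<close> acts on the two facets orthogonal to \<^term>\<open>i\<close> separately.\<close>

lemma covers_sort:
  assumes "covers i P" "k \<noteq> i"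
  shows "covers i (sort_dir k (fst P), sort_label k (fst P) (snd P))"
  unfolding covers_def
proof (intro allI impI)
  fix X assume X: "i \<notin> X" "fst (sort_dir k (fst P), sort_label k (fst P) (snd P)) X"
    "\<not> fst (sort_dir k (fst P), sort_label k (fst P) (snd P)) (insert i X)"
  \<comment> \<open>The upper facet is pulled back along \<open>insert i\<close>, which turns an
    edge in direction \<open>i\<close> into two states at one point, as \<open>charged_sort\<close>
    requires.\<close>
  define G M where "G = (\<lambda>X. fst P (insert i X))" and "M = (\<lambda>X. snd P (insert i X))"
  have "charged i (fst P, snd P) (G, M) Y" if "i \<notin> Y" for Y
    using assms(1) that by (auto simp: covers_def charged_def G_def M_def)
  then have "charged i (sort_dir k (fst P), sort_label k (fst P) (snd P)) (sort_dir k G, sort_label k G M) X"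
    using X(1) assms(2) by (intro charged_sort) auto
  moreover have "insert i X - {k} = insert i (X - {k})" using assms(2) by auto
  then have "sort_dir k G X = sort_dir k (fst P) (insert i X)"
    "sort_label k G M X = sort_label k (fst P) (snd P) (insert i X)"
    using assms(2) by (simp_all add: sort_dir_def sort_label_def G_def M_def insert_commute Let_def)
  ultimately show "i \<in> snd (sort_dir k (fst P), sort_label k (fst P) (snd P)) X
      \<union> snd (sort_dir k (fst P), sort_label k (fst P) (snd P)) (insert i X)"
    using X by (auto simp: charged_def)
qed

lemma covers_sort_list:
  "covers i P \<Longrightarrow> i \<notin> set L \<Longrightarrow> covers i (sort_list L P)"
proof (induction L P rule: sort_list.induct)
  case (2 k L P)
  then have "covers i (sort_dir k (fst P), sort_label k (fst P) (snd P))"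
    by (intro covers_sort) auto
  with 2 show ?case by auto
qed simp

text \<open>Sorting along \<open>i\<close> changes values only at the ends of violated edges in
  direction \<open>i\<close>, where it exchanges the labels too. At such an end the labels before
  and after are those of the two endpoints, and one of them contains \<open>i\<close>.\<close>

lemma charged_sort_dir:
  assumes "covers i P"
  defines "Q \<equiv> (sort_dir i (fst P), sort_label i (fst P) (snd P))"
  shows "charged i P Q X" "charged i Q P X"
proof -
  have cov: "i \<in> snd P (X - {i}) \<union> snd P (insert i X)" if "fst P (X - {i})" "\<not> fst P (insert i X)"
    using assms(1) that unfolding covers_def by (metis Diff_iff insert_Diff_single singletonI)
  have eq: "i \<in> X \<Longrightarrow> insert i X = X" "i \<notin> X \<Longrightarrow> X - {i} = X" by auto
  show "charged i P Q X" "charged i Q P X"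
    using cov by (cases "i \<in> X"; auto simp: eq charged_def Q_def sort_dir_def sort_label_def Let_def)+
qed

text \<open>The runs for \<open>S\<close> and \<open>insert i S\<close> coincide until
  \<open>i\<close> is reached. There \<open>charged_sort_dir\<close> pays for a change in either
  direction, and the common remainder of the list preserves this. Distinctness ensures that
  \<open>i\<close> is met only once.\<close>

lemma tracker_sensitive:
  assumes "distinct L" "covers i P" "i \<notin> S"
    and diff: "fst (sort_list (filter (\<lambda>j. j \<in> S) L) P) X \<noteq> fst (sort_list (filter (\<lambda>j. j \<in> insert i S) L) P) X"
  shows "i \<in> snd (sort_list (filter (\<lambda>j. j \<in> S) L) P) X \<union> snd (sort_list (filter (\<lambda>j. j \<in> insert i S) L) P) X"
proof (cases "i \<in> set L")
  case True
  then obtain K M where L: "L = K @ i # M" by (meson split_list)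
  have filt: "filter (\<lambda>j. j \<in> insert i S) K = filter (\<lambda>j. j \<in> S) K"
    "filter (\<lambda>j. j \<in> insert i S) M = filter (\<lambda>j. j \<in> S) M"
    using assms(1) unfolding L by (auto intro!: filter_cong)
  define P' where "P' = sort_list (filter (\<lambda>j. j \<in> S) K) P"
  define Q' where "Q' = (sort_dir i (fst P'), sort_label i (fst P') (snd P'))"
  have "covers i P'"
    unfolding P'_def using assms(1,2) by (intro covers_sort_list) (auto simp: L)
  then have "charged i P' Q' Y" "charged i Q' P' Y" for Y
    unfolding Q'_def by (rule charged_sort_dir)+
  then have "charged i (sort_list (filter (\<lambda>j. j \<in> S) M) P') (sort_list (filter (\<lambda>j. j \<in> S) M) Q') X"
    "charged i (sort_list (filter (\<lambda>j. j \<in> S) M) Q') (sort_list (filter (\<lambda>j. j \<in> S) M) P') X"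
    by (intro charged_sort_list; simp)+
  moreover have "sort_list (filter (\<lambda>j. j \<in> S) L) P = sort_list (filter (\<lambda>j. j \<in> S) M) P'"
    using assms(3) by (simp add: L P'_def sort_list_append)
  moreover have "sort_list (filter (\<lambda>j. j \<in> insert i S) L) P = sort_list (filter (\<lambda>j. j \<in> S) M) Q'"
    by (simp only: L filter_append filter.simps insertI1 if_True filt sort_list_append sort_list.simps P'_def Q'_def)
  ultimately show ?thesis
    using diff by (auto simp: charged_def)
next
  case False
  then have "filter (\<lambda>j. j \<in> insert i S) L = filter (\<lambda>j. j \<in> S) L"
    by (auto intro!: filter_cong)
  with diff show ?thesis by simp
qed

section \<open>Random sorting and the Boolean inequality\<close>

text \<open>\<open>A\<close> and \<open>D - A\<close> are equidistributed, so union bounds for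
  \<open>g\<close> and for its negation give twice the minimum of \<open>p\<close> and
  \<open>1 - p\<close>, which is at most 4p(1-p).\<close>

lemma cube_avg_compl_neq:
  fixes g :: "'a set \<Rightarrow> bool"
  assumes "finite D"
  defines "p \<equiv> cube_avg D (\<lambda>A. of_bool (g A))"
  shows "cube_avg D (\<lambda>A. of_bool (g A \<noteq> g (D - A))) \<le> 4 * (p * (1 - p))"
proof -
  let ?q = "cube_avg D (\<lambda>A. of_bool (g A \<noteq> g (D - A))) :: real"
  have p': "cube_avg D (\<lambda>A. of_bool (g (D - A))) = p"
    unfolding p_def by (rule cube_avg_compl)
  have "?q \<le> cube_avg D (\<lambda>A. of_bool (g A) + of_bool (g (D - A)))"
    by (intro cube_avg_mono) auto
  then have q1: "?q \<le> 2 * p"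
    by (simp add: cube_avg_add p') (simp add: p_def)
  have "?q + p + p = cube_avg D (\<lambda>A. of_bool (g A \<noteq> g (D - A)) + of_bool (g A) + of_bool (g (D - A)))"
    by (simp add: cube_avg_add p') (simp add: p_def)
  also have "\<dots> \<le> cube_avg D (\<lambda>A. 2)"
    by (intro cube_avg_mono) auto
  finally have q2: "?q \<le> 2 * (1 - p)"
    using assms(1) by (simp add: cube_avg_const)
  have p0: "0 \<le> p" unfolding p_def by (intro cube_avg_nonneg) auto
  have "p \<le> cube_avg D (\<lambda>A. 1)" unfolding p_def by (intro cube_avg_mono) auto
  then have p1: "p \<le> 1" using assms(1) by (simp add: cube_avg_const)
  show ?thesis
  proof (cases "p \<le> 1/2")
    case True
    have "2 * p * 1 \<le> 2 * p * (2 * (1 - p))"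
      using True p0 by (intro mult_left_mono) auto
    with q1 show ?thesis by argo
  next
    case False
    have "2 * (1 - p) * 1 \<le> 2 * (1 - p) * (2 * p)"
      using False p1 by (intro mult_left_mono) auto
    with q2 show ?thesis by argo
  qed
qed

text \<open>For fixed \<open>X\<close>, the value at \<open>X\<close> after sorting along
  \<open>R \<inter> A\<close> is a Boolean function of \<open>A\<close> whose sensitive edges are
  charged by the transported labels. \<open>talagrand_charged\<close> bounds its variance, and
  complementing \<open>A\<close> turns \<open>R \<inter> A\<close> into \<open>R - A\<close>. The
  factor 8 is 4 from \<open>cube_avg_compl_neq\<close> times 2.\<close>

lemma sort_complementary_parts:
  assumes "finite D" "R \<subseteq> D" "distinct L" "set L \<subseteq> D"
    and cov: "\<And>i. i \<in> R \<Longrightarrow> covers i (F, N)"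
  shows "cube_avg D (\<lambda>A. cube_dist D (sort_fun (filter (\<lambda>j. j \<in> R \<inter> A) L) F)
                                    (sort_fun (filter (\<lambda>j. j \<in> R - A) L) F))
    \<le> 8 * cube_avg D (\<lambda>X. sqrt (real (card (N X \<inter> R))))"
proof -
  \<comment> \<open>Labels are cut down to \<open>R\<close>, so that the bound is in terms of
    \<open>N X \<inter> R\<close> and shrinks with \<open>R\<close>.\<close>
  define P where "P = (F, \<lambda>X. N X \<inter> R)"
  define st where "st = (\<lambda>A. sort_list (filter (\<lambda>j. j \<in> R \<inter> A) L) P)"
  define g where "g = (\<lambda>X A. fst (st A) X)"
  define M where "M = (\<lambda>X A. snd (st A) X)"
  have covP: "covers i P" if "i \<in> R" for i
    using cov[OF that] that by (auto simp: covers_def P_def)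
  have st: "(\<forall>X. snd (st A) X \<subseteq> D) \<and> cube_avg D (\<lambda>X. sqrt (real (card (snd (st A) X))))
      \<le> cube_avg D (\<lambda>X. sqrt (real (card (snd P X))))" for A
    unfolding st_def using assms(1,2,4) by (intro cube_avg_sort_list) (auto simp: P_def)
  have tal: "cube_avg D (\<lambda>A. of_bool (g X A \<noteq> g X (D - A))) \<le> 8 * cube_avg D (\<lambda>A. sqrt (real (card (M X A))))" for X
  proof -
    let ?p = "cube_avg D (\<lambda>A. of_bool (g X A)) :: real"
    have "i \<in> M X A \<union> M X (insert i A)"
      if "A \<subseteq> D" "i \<in> D - A" "g X A \<noteq> g X (insert i A)" for A i
    proof (cases "i \<in> R")
      case True
      then have "R \<inter> insert i A = insert i (R \<inter> A)" by auto
      then have st': "st (insert i A) = sort_list (filter (\<lambda>j. j \<in> insert i (R \<inter> A)) L) P"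
        by (simp only: st_def)
      have "i \<notin> R \<inter> A" using that by simp
      then show ?thesis
        using that(3) unfolding M_def g_def st' unfolding st_def
        by (rule tracker_sensitive[OF assms(3) covP[OF True]])
    next
      case False
      then have "R \<inter> insert i A = R \<inter> A" by auto
      then have "st (insert i A) = st A" by (simp only: st_def)
      with that show ?thesis by (simp add: g_def)
    qed
    moreover have "finite (M X A)" for A
      using st assms(1) unfolding M_def by (meson finite_subset)
    ultimately have "?p * (1 - ?p) / 2 \<le> cube_avg D (\<lambda>A. sqrt (real (card (M X A))))"
      using assms(1) by (intro talagrand_charged) auto
    moreover have "cube_avg D (\<lambda>A. of_bool (g X A \<noteq> g X (D - A))) \<le> 4 * (?p * (1 - ?p))"
      using assms(1) by (rule cube_avg_compl_neq)
    ultimately show ?thesis by simp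
  qed
  have g: "sort_fun (filter (\<lambda>j. j \<in> R \<inter> A) L) F X = g X A" for A X
    by (simp add: g_def st_def P_def fst_sort_list)
  have "R \<inter> (D - A) = R - A" for A using assms(2) by auto
  then have g': "sort_fun (filter (\<lambda>j. j \<in> R - A) L) F X = g X (D - A)" for A X
    using g[of "D - A" X] by metis
  have "cube_avg D (\<lambda>A. cube_dist D (sort_fun (filter (\<lambda>j. j \<in> R \<inter> A) L) F)
                                    (sort_fun (filter (\<lambda>j. j \<in> R - A) L) F))
      = cube_avg D (\<lambda>X. cube_avg D (\<lambda>A. of_bool (g X A \<noteq> g X (D - A))))"
    unfolding cube_dist_def g g' by (rule cube_avg_swap)
  also have "\<dots> \<le> cube_avg D (\<lambda>X. 8 * cube_avg D (\<lambda>A. sqrt (real (card (M X A)))))"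
    by (intro cube_avg_mono tal)
  also have "\<dots> = 8 * cube_avg D (\<lambda>A. cube_avg D (\<lambda>X. sqrt (real (card (M X A)))))"
    by (simp add: cube_avg_mult cube_avg_swap[of D _ "\<lambda>X A. sqrt (real (card (M X A)))"])
  also have "\<dots> \<le> 8 * cube_avg D (\<lambda>A. cube_avg D (\<lambda>X. sqrt (real (card (snd P X)))))"
    using st by (simp add: M_def cube_avg_mono[of D "\<lambda>A. cube_avg D (\<lambda>X. sqrt (real (card (snd (st A) X))))"])
  finally show ?thesis
    using assms(1) by (simp add: cube_avg_const P_def)
qed

text \<open>An inverse riffle shuffle. It is stable: the order induced on \<open>R\<close> is that
  of \<open>L\<close> on \<open>R \<inter> A\<close>, followed by that of \<open>L\<close> on
  \<open>R - A\<close>.\<close>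

definition unshuffle :: "'a set \<Rightarrow> 'a list \<Rightarrow> 'a list" where
  "unshuffle A L = filter (\<lambda>j. j \<in> A) L @ filter (\<lambda>j. j \<notin> A) L"

lemma set_unshuffle [simp]: "set (unshuffle A L) = set L"
  by (auto simp: unshuffle_def)

lemma distinct_unshuffle [simp]: "distinct L \<Longrightarrow> distinct (unshuffle A L)"
  by (auto simp: unshuffle_def)

lemma filter_unshuffle:
  "filter (\<lambda>j. j \<in> R) (unshuffle A L) = filter (\<lambda>j. j \<in> R \<inter> A) L @ filter (\<lambda>j. j \<in> R - A) L"
  by (simp add: unshuffle_def conj_commute)

text \<open>Sorting along \<open>R\<close> is now sorting along \<open>R \<inter> A\<close>, then
  along \<open>R - A\<close>. The second stage is controlled by the distance between the two partial
  sortings, which enters twice; 16 is 2 times the 8 of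
  \<open>sort_complementary_parts\<close>.\<close>

lemma sort_unshuffle:
  assumes "finite D" "R \<subseteq> D" "distinct L" "set L \<subseteq> D"
    and "\<And>i. i \<in> R \<Longrightarrow> covers i (F, N)"
  shows "cube_avg D (\<lambda>A. cube_dist D F (sort_fun (filter (\<lambda>j. j \<in> R) (unshuffle A L)) F))
    \<le> cube_avg D (\<lambda>A. cube_dist D F (sort_fun (filter (\<lambda>j. j \<in> R \<inter> A) L) F))
      + 16 * cube_avg D (\<lambda>X. sqrt (real (card (N X \<inter> R))))"
proof -
  define U where "U = (\<lambda>A. filter (\<lambda>j. j \<in> R \<inter> A) L)"
  define V where "V = (\<lambda>A. filter (\<lambda>j. j \<in> R - A) L)"
  have "cube_dist D F (sort_fun (filter (\<lambda>j. j \<in> R) (unshuffle A L)) F)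
      \<le> cube_dist D F (sort_fun (U A) F) + 2 * cube_dist D (sort_fun (U A) F) (sort_fun (V A) F)" for A
  proof -
    \<comment> \<open>Sorting \<open>F\<close> along \<open>V A\<close> twice is the same as once,
      so contraction compares \<open>V A\<close> applied to the two partial sortings.\<close>
    have "cube_dist D (sort_fun (V A) (sort_fun (V A) F)) (sort_fun (V A) (sort_fun (U A) F))
        \<le> cube_dist D (sort_fun (V A) F) (sort_fun (U A) F)"
      using assms(1,4) by (intro cube_dist_sort_fun) (auto simp: V_def)
    then have "cube_dist D (sort_fun (V A) F) (sort_fun (V A) (sort_fun (U A) F))
        \<le> cube_dist D (sort_fun (U A) F) (sort_fun (V A) F)"
      by (simp add: sort_fun_idem cube_dist_sym)
    moreover have "sort_fun (filter (\<lambda>j. j \<in> R) (unshuffle A L)) F = sort_fun (V A) (sort_fun (U A) F)"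
      unfolding filter_unshuffle U_def V_def by (rule sort_fun_append)
    ultimately show ?thesis
      using cube_dist_triangle[of D F "sort_fun (V A) (sort_fun (U A) F)" "sort_fun (U A) F"]
        cube_dist_triangle[of D "sort_fun (U A) F" "sort_fun (V A) (sort_fun (U A) F)" "sort_fun (V A) F"]
      by simp
  qed
  then have "cube_avg D (\<lambda>A. cube_dist D F (sort_fun (filter (\<lambda>j. j \<in> R) (unshuffle A L)) F))
      \<le> cube_avg D (\<lambda>A. cube_dist D F (sort_fun (U A) F) + 2 * cube_dist D (sort_fun (U A) F) (sort_fun (V A) F))"
    by (rule cube_avg_mono)
  also have "\<dots> = cube_avg D (\<lambda>A. cube_dist D F (sort_fun (U A) F))
      + 2 * cube_avg D (\<lambda>A. cube_dist D (sort_fun (U A) F) (sort_fun (V A) F))"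
    by (simp add: cube_avg_add cube_avg_mult)
  also have "\<dots> \<le> cube_avg D (\<lambda>A. cube_dist D F (sort_fun (U A) F))
      + 2 * (8 * cube_avg D (\<lambda>X. sqrt (real (card (N X \<inter> R)))))"
    unfolding U_def V_def using assms by (intro add_left_mono mult_left_mono sort_complementary_parts) auto
  finally show ?thesis by (simp add: U_def)
qed

text \<open>Expectation over the order obtained by unshuffling \<^term>\<open>L\<close> along \<^term>\<open>k\<close> independent uniform subsets.\<close>

fun unshuffle_avg :: "'a set \<Rightarrow> nat \<Rightarrow> ('a list \<Rightarrow> real) \<Rightarrow> 'a list \<Rightarrow> real" where
  "unshuffle_avg D 0 h L = h L"
| "unshuffle_avg D (Suc k) h L = unshuffle_avg D k (\<lambda>L. cube_avg D (\<lambda>A. h (unshuffle A L))) L"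

lemma unshuffle_avg_mono:
  assumes "\<And>K. distinct K \<Longrightarrow> set K = set L \<Longrightarrow> h K \<le> h' K" "distinct L"
  shows "unshuffle_avg D k h L \<le> unshuffle_avg D k h' L"
  using assms(1)
proof (induction k arbitrary: h h')
  case (Suc k)
  show ?case
    unfolding unshuffle_avg.simps
    by (intro Suc.IH cube_avg_mono Suc.prems) auto
qed (use assms(2) in simp)

lemma unshuffle_avg_add_const:
  "finite D \<Longrightarrow> unshuffle_avg D k (\<lambda>L. h L + c) L = unshuffle_avg D k h L + c"
  by (induction k arbitrary: h) (auto simp: cube_avg_add cube_avg_const)

lemma unshuffle_avg_const:
  "finite D \<Longrightarrow> unshuffle_avg D k (\<lambda>L. c) L = c"
  by (induction k) (auto simp: cube_avg_const)

lemma unshuffle_avg_cube_avg: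
  "unshuffle_avg D k (\<lambda>L. cube_avg E (\<lambda>A. h A L)) L = cube_avg E (\<lambda>A. unshuffle_avg D k (h A) L)"
proof (induction k arbitrary: h)
  case (Suc k)
  have "unshuffle_avg D (Suc k) (\<lambda>L. cube_avg E (\<lambda>A. h A L)) L
      = unshuffle_avg D k (\<lambda>L. cube_avg E (\<lambda>A. cube_avg D (\<lambda>B. h A (unshuffle B L)))) L"
    by (simp add: cube_avg_swap[of D E])
  also have "\<dots> = cube_avg E (\<lambda>A. unshuffle_avg D k (\<lambda>L. cube_avg D (\<lambda>B. h A (unshuffle B L))) L)"
    by (rule Suc.IH)
  finally show ?case by simp
qed simp

text \<open>\<open>A\<close> and \<open>D - A\<close> are equidistributed, and their traces on
  \<open>R\<close> have sizes adding up to \<open>card R\<close>.\<close>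

lemma cube_avg_card_Int:
  assumes "finite D" "R \<subseteq> D"
  shows "cube_avg D (\<lambda>A. real (card (R \<inter> A))) = real (card R) / 2"
proof -
  have fin: "finite R" using assms finite_subset by auto
  have "cube_avg D (\<lambda>A. real (card (R \<inter> A))) + cube_avg D (\<lambda>A. real (card (R \<inter> (D - A))))
      = cube_avg D (\<lambda>A. real (card R))"
    unfolding cube_avg_add[symmetric]
  proof (rule cube_avg_cong)
    fix A
    have "card R = card ((R \<inter> A) \<union> (R \<inter> (D - A)))"
      using assms by (intro arg_cong[where f = card]) auto
    also have "\<dots> = card (R \<inter> A) + card (R \<inter> (D - A))"
      using fin by (intro card_Un_disjoint) auto
    finally show "real (card (R \<inter> A)) + real (card (R \<inter> (D - A))) = real (card R)" by simp
  qed
  then show ?thesis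
    using assms cube_avg_compl[of D "\<lambda>A. real (card (R \<inter> A))"] by (simp add: cube_avg_const)
qed

text \<open>Jensen with mean \<open>card R / 2\<close>, carried out by bounding the square root by
  its tangent at m^2. The constant 3/4 is a rational number above the square root of 1/2.\<close>

lemma cube_avg_sqrt_card_Int:
  assumes "finite D" "R \<subseteq> D"
  shows "cube_avg D (\<lambda>A. sqrt (real (card (R \<inter> A)))) \<le> 3/4 * sqrt (real (card R))"
proof (cases "card R = 0")
  case True
  then have "R = {}" using finite_subset[OF assms(2,1)] by simp
  then show ?thesis using assms by (simp add: cube_avg_const)
next
  case False
  define m where "m = 3/4 * sqrt (real (card R))"
  have m: "0 < m" "real (card R) = 16/9 * (m * m)" using False by (auto simp: m_def)
  have "sqrt x \<le> 1 / (2 * m) * x + m / 2" if "0 \<le> x" for x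
  proof -
    have "0 \<le> (sqrt x - m)\<^sup>2" by simp
    then have "2 * m * sqrt x \<le> x + m * m"
      using that by (simp add: power2_diff power2_eq_square[of m] mult.commute mult.left_commute)
    then show ?thesis using m(1) by (simp add: field_simps)
  qed
  then have "cube_avg D (\<lambda>A. sqrt (real (card (R \<inter> A))))
      \<le> cube_avg D (\<lambda>A. 1 / (2 * m) * real (card (R \<inter> A)) + m / 2)"
    by (intro cube_avg_mono) auto
  also have "\<dots> = 1 / (2 * m) * (real (card R) / 2) + m / 2"
    unfolding cube_avg_add cube_avg_mult using assms by (simp add: cube_avg_card_Int cube_avg_const)
  also have "\<dots> \<le> m" using m by (simp add: field_simps)
  finally show ?thesis by (simp add: m_def)
qed

text \<open>Each unshuffling costs 16 times the label functional and passes to a random half of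
  \<open>R\<close>, on which that functional shrinks to 3/4. The constant 64 solves 3c/4 + 16 =
  c.\<close>

lemma unshuffle_avg_dist_sorted:
  assumes "finite D" "R \<subseteq> D" "distinct L" "set L \<subseteq> D"
    and "\<And>i. i \<in> R \<Longrightarrow> covers i (F, N)"
  shows "unshuffle_avg D k (\<lambda>L. cube_dist D F (sort_fun (filter (\<lambda>j. j \<in> R) L) F)) L
    \<le> 64 * cube_avg D (\<lambda>X. sqrt (real (card (N X \<inter> R)))) + real (card R) / 2 ^ k"
  using assms(2,5)
proof (induction k arbitrary: R)
  case 0
  have T: "0 \<le> cube_avg D (\<lambda>X. sqrt (real (card (N X \<inter> R))))"
    by (intro cube_avg_nonneg) auto
  \<comment> \<open>For empty \<open>R\<close> nothing is sorted; otherwise the trivial bound 1 on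
    the distance is absorbed by \<open>card R\<close>.\<close>
  show ?case
  proof (cases "R = {}")
    case True
    then show ?thesis using assms(1) by (simp add: sort_fun_def cube_dist_def cube_avg_const)
  next
    case False
    then have "1 \<le> card R" using 0 assms(1) by (simp add: Suc_leI card_gt_0_iff finite_subset)
    then show ?thesis
      using T cube_dist_le_1[OF assms(1), of F "sort_fun (filter (\<lambda>j. j \<in> R) L) F"] by simp
  qed
next
  case (Suc k)
  define T where "T = (\<lambda>R. cube_avg D (\<lambda>X. sqrt (real (card (N X \<inter> R)))))"
  \<comment> \<open>The last unshuffling is peeled off. The induction hypothesis is then applied to
    \<open>R \<inter> A\<close> for each fixed \<open>A\<close>, hence \<open>R\<close> is arbitrary
    in the induction.\<close>
  have "unshuffle_avg D (Suc k) (\<lambda>L. cube_dist D F (sort_fun (filter (\<lambda>j. j \<in> R) L) F)) L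
      \<le> unshuffle_avg D k (\<lambda>L. cube_avg D (\<lambda>A. cube_dist D F (sort_fun (filter (\<lambda>j. j \<in> R \<inter> A) L) F)) + 16 * T R) L"
    unfolding unshuffle_avg.simps T_def
    using assms(1,3,4) Suc.prems by (intro unshuffle_avg_mono sort_unshuffle) auto
  also have "\<dots> = cube_avg D (\<lambda>A. unshuffle_avg D k (\<lambda>L. cube_dist D F (sort_fun (filter (\<lambda>j. j \<in> R \<inter> A) L) F)) L) + 16 * T R"
    using assms(1) by (simp only: unshuffle_avg_add_const unshuffle_avg_cube_avg)
  also have "\<dots> \<le> cube_avg D (\<lambda>A. 64 * T (R \<inter> A) + 1 / 2 ^ k * real (card (R \<inter> A))) + 16 * T R"
  proof (intro add_right_mono cube_avg_mono)
    fix A assume "A \<subseteq> D"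
    have "unshuffle_avg D k (\<lambda>L. cube_dist D F (sort_fun (filter (\<lambda>j. j \<in> R \<inter> A) L) F)) L
        \<le> 64 * T (R \<inter> A) + real (card (R \<inter> A)) / 2 ^ k"
      unfolding T_def using Suc.prems by (intro Suc.IH) auto
    then show "unshuffle_avg D k (\<lambda>L. cube_dist D F (sort_fun (filter (\<lambda>j. j \<in> R \<inter> A) L) F)) L
        \<le> 64 * T (R \<inter> A) + 1 / 2 ^ k * real (card (R \<inter> A))" by simp
  qed
  also have "\<dots> = 64 * cube_avg D (\<lambda>A. T (R \<inter> A)) + real (card R) / 2 ^ Suc k + 16 * T R"
    unfolding cube_avg_add cube_avg_mult using assms(1) Suc.prems by (simp add: cube_avg_card_Int)
  also have "cube_avg D (\<lambda>A. T (R \<inter> A)) \<le> 3/4 * T R"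
  proof -
    have "cube_avg D (\<lambda>A. T (R \<inter> A)) = cube_avg D (\<lambda>X. cube_avg D (\<lambda>A. sqrt (real (card (N X \<inter> R \<inter> A)))))"
      unfolding T_def by (subst cube_avg_swap) (simp add: Int_assoc)
    also have "\<dots> \<le> cube_avg D (\<lambda>X. 3/4 * sqrt (real (card (N X \<inter> R))))"
      using assms(1) Suc.prems by (intro cube_avg_mono cube_avg_sqrt_card_Int) auto
    also have "\<dots> = 3/4 * T R" by (simp only: T_def cube_avg_mult)
    finally show ?thesis .
  qed
  finally show ?case by (simp add: T_def)
qed

text \<open>Every order of \<open>D\<close> sorts \<open>F\<close> completely, so \<open>far\<close>
  applies to each outcome of the random order. Letting the number of unshufflings grow removes the
  error \<open>card D / 2 ^ k\<close>.\<close>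

theorem boolean_dist_le:
  assumes "finite D" and N: "\<And>X. N X \<subseteq> D"
    and cov: "\<And>i. i \<in> D \<Longrightarrow> covers i (F, N)"
    and far: "\<And>G. (\<And>i. i \<in> D \<Longrightarrow> sorted_dir i G) \<Longrightarrow> \<delta> \<le> cube_dist D F G"
  shows "\<delta> \<le> 64 * cube_avg D (\<lambda>X. sqrt (real (card (N X))))"
proof (rule field_le_epsilon)
  fix e :: real assume "0 < e"
  obtain L where L: "distinct L" "set L = D"
    using finite_distinct_list[OF assms(1)] by blast
  have "(\<lambda>k. real (card D) / 2 ^ k) \<longlonglongrightarrow> 0"
    by (intro LIMSEQ_divide_realpow_zero) simp
  then obtain k where k: "real (card D) / 2 ^ k < e"
    using \<open>0 < e\<close> order_tendstoD(2) eventually_sequentially by (metis order_refl)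
  have "\<delta> = unshuffle_avg D k (\<lambda>L. \<delta>) L"
    using assms(1) by (simp add: unshuffle_avg_const)
  also have "\<dots> \<le> unshuffle_avg D k (\<lambda>L. cube_dist D F (sort_fun (filter (\<lambda>j. j \<in> D) L) F)) L"
    using L by (intro unshuffle_avg_mono far sorted_dir_sort_fun) auto
  also have "\<dots> \<le> 64 * cube_avg D (\<lambda>X. sqrt (real (card (N X \<inter> D)))) + real (card D) / 2 ^ k"
    using assms(1) L cov by (intro unshuffle_avg_dist_sorted) auto
  also have "\<dots> = 64 * cube_avg D (\<lambda>X. sqrt (real (card (N X)))) + real (card D) / 2 ^ k"
    using N by (simp add: Int_absorb2)
  finally show "\<delta> \<le> 64 * cube_avg D (\<lambda>X. sqrt (real (card (N X)))) + e"
    using k by simp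
qed

section \<open>Boolean decomposition of a real-valued function\<close>

text \<open>A perfect matching of \<open>A\<close> upwards onto \<open>B\<close>. Only its existence
  is recorded, which leaves room for rerouting.\<close>

definition linked :: "'a set set \<Rightarrow> 'a set set \<Rightarrow> bool" where
  "linked A B \<longleftrightarrow> (\<exists>h. bij_betw h A B \<and> (\<forall>s\<in>A. s \<subseteq> h s))"

lemma linked_empty: "linked {} {}"
  by (auto simp: linked_def)

lemma linked_insert:
  assumes "linked A B" "s \<subseteq> t" "s \<notin> A" "t \<notin> B"
  shows "linked (insert s A) (insert t B)"
proof -
  obtain h where h: "bij_betw h A B" "\<forall>x\<in>A. x \<subseteq> h x" using assms(1) by (auto simp: linked_def)
  have "bij_betw (h(s := t)) A B"
    using h(1) assms(3) by (subst bij_betw_cong[of A _ h]) auto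
  then have "bij_betw (h(s := t)) (insert s A) (insert t B)"
    using assms(3,4) notIn_Un_bij_betw[of s A "h(s := t)" B] by simp
  then show ?thesis
    using h(2) assms(2,3) unfolding linked_def by (intro exI[of _ "h(s := t)"]) auto
qed

lemma linked_Un:
  assumes "linked A B" "linked A' B'" "A \<inter> A' = {}" "B \<inter> B' = {}"
  shows "linked (A \<union> A') (B \<union> B')"
proof -
  obtain h where h: "bij_betw h A B" "\<forall>x\<in>A. x \<subseteq> h x" using assms(1) by (auto simp: linked_def)
  obtain h' where h': "bij_betw h' A' B'" "\<forall>x\<in>A'. x \<subseteq> h' x" using assms(2) by (auto simp: linked_def)
  define k where "k = (\<lambda>x. if x \<in> A then h x else h' x)"
  have "bij_betw k A B" using h(1) by (subst bij_betw_cong[of A _ h]) (auto simp: k_def)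
  moreover have "bij_betw k A' B'"
    using h'(1) assms(3) by (subst bij_betw_cong[of A' _ h']) (auto simp: k_def)
  ultimately have "bij_betw k (A \<union> A') (B \<union> B')"
    using assms(4) by (rule bij_betw_combine)
  then show ?thesis
    using h(2) h'(2) unfolding linked_def by (intro exI[of _ k]) (auto simp: k_def)
qed

lemma linked_subset:
  "bij_betw b S T \<Longrightarrow> (\<And>s. s \<in> S \<Longrightarrow> s \<subseteq> b s) \<Longrightarrow> A \<subseteq> S \<Longrightarrow> linked A (b ` A)"
  unfolding linked_def by (meson bij_betw_subset order_refl subsetD)

definition matching_weight :: "('a set \<Rightarrow> real) \<Rightarrow> 'a set set \<Rightarrow> 'a set set \<Rightarrow> real" where
  "matching_weight f S T = sum f S - sum f T"

definition matchable :: "'a set \<Rightarrow> 'a set set \<Rightarrow> 'a set set \<Rightarrow> bool" where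
  "matchable D S T \<longleftrightarrow> S \<subseteq> Pow D \<and> T \<subseteq> Pow D \<and> S \<inter> T = {} \<and> linked S T"

text \<open>
  A matchable pair of maximal weight and, among those, of minimal size.  The weight does not
  depend on the matching itself, so rerouting the matching is free.
\<close>

lemma ex_optimal_matchable:
  assumes "finite D"
  obtains S T where "matchable D S T"
    "\<And>S' T'. matchable D S' T' \<Longrightarrow> matching_weight f S' T' \<le> matching_weight f S T"
    "\<And>S' T'. matchable D S' T' \<Longrightarrow> matching_weight f S' T' = matching_weight f S T \<Longrightarrow> card S \<le> card S'"
proof -
  define Q where "Q = {(S, T). matchable D S T}"
  define w where "w = (\<lambda>(S, T). matching_weight f S T)"
  have "Q \<subseteq> Pow (Pow D) \<times> Pow (Pow D)" by (auto simp: Q_def matchable_def)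
  then have fin: "finite Q" using assms by (meson finite_Pow_iff finite_SigmaI finite_subset)
  have ne: "Q \<noteq> {}" using linked_empty by (auto simp: Q_def matchable_def)
  define Q' where "Q' = {q \<in> Q. w q = Max (w ` Q)}"
  have "Max (w ` Q) \<in> w ` Q" using fin ne by simp
  then obtain q0 where "q0 \<in> Q" "Max (w ` Q) = w q0" by (rule imageE)
  then have "q0 \<in> Q'" by (simp add: Q'_def)
  then obtain q where q: "q \<in> Q'" "\<And>q'. q' \<in> Q' \<Longrightarrow> card (fst q) \<le> card (fst q')"
    using ex_has_least_nat[of "\<lambda>q. q \<in> Q'" _ "\<lambda>q. card (fst q)"] by blast
  show thesis
  proof (rule that[of "fst q" "snd q"])
    show "matchable D (fst q) (snd q)" using q(1) by (auto simp: Q'_def Q_def)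
    have wq: "w q = matching_weight f (fst q) (snd q)" "w q = Max (w ` Q)"
      using q(1) by (auto simp: w_def Q'_def case_prod_beta)
    fix S' T' assume S': "matchable D S' T'"
    then have "w (S', T') \<le> Max (w ` Q)" using fin by (intro Max_ge) (auto simp: Q_def)
    then show "matching_weight f S' T' \<le> matching_weight f (fst q) (snd q)"
      using wq by (simp add: w_def)
    assume "matching_weight f S' T' = matching_weight f (fst q) (snd q)"
    then have "(S', T') \<in> Q'" using S' wq by (simp add: Q'_def Q_def w_def)
    then show "card (fst q) \<le> card S'" using q(2) by force
  qed
qed

section \<open>Clusters of matched pairs\<close>

text \<open>In an optimal pair this forces every bottom of the cluster to have a larger value than
  every top, by \<open>optimal_exchange\<close>, so that one threshold separates them.\<close>

definition exchangeable :: "('a set \<Rightarrow> 'a set) \<Rightarrow> 'a set set \<Rightarrow> bool" where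
  "exchangeable b A \<longleftrightarrow> (\<forall>s\<in>A. \<forall>t\<in>b ` A. linked (A - {s}) (b ` A - {t}))"

lemma exchangeableD:
  "exchangeable b A \<Longrightarrow> s \<in> A \<Longrightarrow> t \<in> b ` A \<Longrightarrow> linked (A - {s}) (b ` A - {t})"
  unfolding exchangeable_def by blast

text \<open>The region where the threshold function of a cluster follows \<open>f\<close>. Its two
  ends may come from different pairs, since a violated edge of that function only lies between some
  bottom and some top.\<close>

definition sweep :: "('a set \<Rightarrow> 'a set) \<Rightarrow> 'a set set \<Rightarrow> 'a set set" where
  "sweep b A = {z. \<exists>s\<in>A. \<exists>s'\<in>A. s \<subseteq> z \<and> z \<subseteq> b s'}"

text \<open>
  If the sweeps of two clusters share a point, then bottom points of either cluster lie below top
  points of the other, so a pair deleted across the clusters can be bypassed.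
\<close>

lemma exchangeable_Un:
  assumes b: "bij_betw b S T" "\<And>s. s \<in> S \<Longrightarrow> s \<subseteq> b s"
    and A: "A \<subseteq> S" "A' \<subseteq> S" "A \<inter> A' = {}"
    and ex: "exchangeable b A" "exchangeable b A'"
    and meet: "sweep b A \<inter> sweep b A' \<noteq> {}"
  shows "exchangeable b (A \<union> A')"
proof -
  have cross: "linked (C \<union> C' - {s}) (b ` (C \<union> C') - {t})"
    if C: "C \<subseteq> S" "C' \<subseteq> S" "C \<inter> C' = {}" "exchangeable b C" "exchangeable b C'"
      "sweep b C \<inter> sweep b C' \<noteq> {}" "s \<in> C" "t \<in> b ` (C \<union> C')" for C C' s t
  proof -
    have disj: "b ` C \<inter> b ` C' = {}"
      using inj_on_image_Int[of b S C C'] C(1-3) b(1) by (simp add: bij_betw_def)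
    show ?thesis
    proof (cases "t \<in> b ` C")
      case True
      have "linked ((C - {s}) \<union> C') ((b ` C - {t}) \<union> b ` C')"
      proof (rule linked_Un)
        show "linked (C - {s}) (b ` C - {t})" using C(4,7) True by (rule exchangeableD)
        show "linked C' (b ` C')" using b C(2) by (rule linked_subset)
      qed (use C(3) disj in blast)+
      moreover have "(C - {s}) \<union> C' = C \<union> C' - {s}" "(b ` C - {t}) \<union> b ` C' = b ` (C \<union> C') - {t}"
        using C(3,7) disj True by auto
      ultimately show ?thesis by simp
    next
      case False
      then have t: "t \<in> b ` C'" using C(8) by auto
      \<comment> \<open>A common point of the sweeps lies above \<open>c\<close> and below
        \<open>b u\<close>. Deleting \<open>s\<close> with \<open>b u\<close> and \<open>c\<close>
        with \<open>t\<close> inside the two clusters, then adding the pair of \<open>c\<close> and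
        \<open>b u\<close>, deletes \<open>s\<close> and \<open>t\<close> in total.\<close>
      obtain c u where cu: "c \<in> C'" "u \<in> C" "c \<subseteq> b u"
        using C(6) unfolding sweep_def by blast
      have "linked ((C - {s}) \<union> (C' - {c})) ((b ` C - {b u}) \<union> (b ` C' - {t}))"
      proof (rule linked_Un)
        show "linked (C - {s}) (b ` C - {b u})" using C(4,7) cu(2) by (intro exchangeableD) auto
        show "linked (C' - {c}) (b ` C' - {t})" using C(5) cu(1) t by (rule exchangeableD)
      qed (use C(3) disj in blast)+
      then have "linked (insert c ((C - {s}) \<union> (C' - {c}))) (insert (b u) ((b ` C - {b u}) \<union> (b ` C' - {t})))"
        using cu C(3) disj by (intro linked_insert) auto
      moreover have "insert c ((C - {s}) \<union> (C' - {c})) = C \<union> C' - {s}"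
        using C(3,7) cu by auto
      moreover have "insert (b u) ((b ` C - {b u}) \<union> (b ` C' - {t})) = b ` (C \<union> C') - {t}"
        using cu disj t by auto
      ultimately show ?thesis by simp
    qed
  qed
  show ?thesis
    unfolding exchangeable_def
  proof (intro ballI)
    fix s t assume s: "s \<in> A \<union> A'" and t: "t \<in> b ` (A \<union> A')"
    show "linked (A \<union> A' - {s}) (b ` (A \<union> A') - {t})"
    proof (cases "s \<in> A")
      case True
      then show ?thesis using cross[of A A' s t] A ex meet t by simp
    next
      case False
      then show ?thesis using cross[of A' A s t] A ex meet s t by (simp add: Un_commute Int_commute)
    qed
  qed
qed

text \<open>Singletons are exchangeable. In a partition into exchangeable blocks with the fewest
  blocks, no two sweeps meet, since such blocks could be merged by
  \<open>exchangeable_Un\<close>.\<close>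

lemma ex_disjoint_clusters:
  assumes b: "bij_betw b S T" "\<And>s. s \<in> S \<Longrightarrow> s \<subseteq> b s" and "finite S"
  obtains \<A> where "partition_on S \<A>" "\<And>A. A \<in> \<A> \<Longrightarrow> exchangeable b A"
    "\<And>A A'. A \<in> \<A> \<Longrightarrow> A' \<in> \<A> \<Longrightarrow> A \<noteq> A' \<Longrightarrow> sweep b A \<inter> sweep b A' = {}"
proof -
  define good where "good = (\<lambda>\<A>. partition_on S \<A> \<and> (\<forall>A\<in>\<A>. exchangeable b A))"
  have "good ((\<lambda>s. {s}) ` S)"
    by (auto simp: good_def exchangeable_def linked_empty partition_on_def disjoint_def)
  then obtain \<A> where \<A>: "good \<A>" "\<And>\<B>. good \<B> \<Longrightarrow> card \<A> \<le> card \<B>"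
    using ex_has_least_nat[of good _ card] by blast
  have part: "partition_on S \<A>" and ex: "\<And>A. A \<in> \<A> \<Longrightarrow> exchangeable b A"
    using \<A>(1) by (auto simp: good_def)
  show thesis
  proof (rule that[OF part ex])
    fix A A' assume A: "A \<in> \<A>" "A' \<in> \<A>" "A \<noteq> A'"
    have fin: "finite \<A>" using assms(3) part by (rule finite_elements)
    have sub: "A \<subseteq> S" "A' \<subseteq> S" "A \<inter> A' = {}" "A \<noteq> {}"
      using part A by (auto simp: partition_on_def disjoint_def)
    show "sweep b A \<inter> sweep b A' = {}"
    proof (rule ccontr)
      assume meet: "sweep b A \<inter> sweep b A' \<noteq> {}"
      define \<B> where "\<B> = insert (A \<union> A') (\<A> - {A, A'})"
      have "exchangeable b (A \<union> A')"
        using sub A ex meet by (intro exchangeable_Un[OF b]) auto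
      moreover have "partition_on S \<B>"
      proof (rule partition_onI)
        show "\<Union>\<B> = S" using part A by (auto simp: \<B>_def partition_on_def)
        show "{} \<notin> \<B>"
          using sub part by (auto simp: \<B>_def partition_on_def)
        show "disjnt p q" if "p \<in> \<B>" "q \<in> \<B>" "p \<noteq> q" for p q
        proof -
          have disj: "B \<inter> B' = {}" if "B \<in> \<A>" "B' \<in> \<A>" "B \<noteq> B'" for B B'
            using part that by (auto simp: partition_on_def disjoint_def)
          have "(A \<union> A') \<inter> B = {}" if "B \<in> \<A> - {A, A'}" for B
            using disj[of A B] disj[of A' B] A that by blast
          then show ?thesis using that disj[of p q] unfolding \<B>_def disjnt_def by blast
        qed
      qed
      moreover have "exchangeable b B" if "B \<in> \<A> - {A, A'}" for B using ex that by simp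
      ultimately have "good \<B>" unfolding good_def \<B>_def by simp
      then have "card \<A> \<le> card \<B>" by (rule \<A>(2))
      also have "card \<B> \<le> Suc (card (\<A> - {A, A'}))"
        unfolding \<B>_def using fin by (simp add: card_insert_if)
      also have "card (\<A> - {A, A'}) = card \<A> - 2"
        using A fin by (subst card_Diff_subset) auto
      finally show False
        using A fin card_mono[of \<A> "{A, A'}"] by auto
    qed
  qed
qed

text \<open>Deleting \<open>s\<close> and \<open>t\<close> changes the weight by
  \<open>f t - f s\<close>. Were this nonnegative, a smaller pair of at least the same weight would
  exist.\<close>

lemma optimal_exchange:
  fixes f :: "'a set \<Rightarrow> real"
  assumes S: "matchable D S T"
    "\<And>S' T'. matchable D S' T' \<Longrightarrow> matching_weight f S' T' \<le> matching_weight f S T"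
    "\<And>S' T'. matchable D S' T' \<Longrightarrow> matching_weight f S' T' = matching_weight f S T \<Longrightarrow> card S \<le> card S'"
    and "finite D" "s \<in> S" "t \<in> T" and link: "linked (S - {s}) (T - {t})"
  shows "f t < f s"
proof (rule ccontr)
  assume neg: "\<not> f t < f s"
  have fin: "finite S" "finite T"
    using S(1) assms(4) by (auto simp: matchable_def intro: finite_subset)
  have "matchable D (S - {s}) (T - {t})"
    using S(1) link by (auto simp: matchable_def)
  moreover have w: "matching_weight f (S - {s}) (T - {t}) = matching_weight f S T - f s + f t"
    using fin assms(5,6) by (simp add: matching_weight_def sum_diff1)
  ultimately have "card S \<le> card (S - {s})"
    using S(2)[of "S - {s}" "T - {t}"] S(3)[of "S - {s}" "T - {t}"] neg by auto
  with fin(1) assms(5) show False by (metis card_Diff1_less not_le)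
qed

text \<open>A threshold between tops and bottoms gives a Boolean function whose violated edges all
  lie in the sweep and are violated by \<open>f\<close>. It is 1 on bottoms and 0 on tops, so a
  monotone function errs on each of the disjoint pairs.\<close>

lemma cluster_bound:
  fixes f :: "'a set \<Rightarrow> real"
  assumes D: "finite D" and A: "A \<subseteq> Pow D" "A \<noteq> {}" and b: "inj_on b A" "b ` A \<subseteq> Pow D" "A \<inter> b ` A = {}"
    and le: "\<And>s. s \<in> A \<Longrightarrow> s \<subseteq> b s"
    and gap: "\<And>s t. s \<in> A \<Longrightarrow> t \<in> b ` A \<Longrightarrow> f t < f s"
    and N: "\<And>X. N X \<subseteq> D"
    and cov: "\<And>i X. i \<in> D \<Longrightarrow> X \<subseteq> D - {i} \<Longrightarrow> f (insert i X) < f X \<Longrightarrow> i \<in> N X \<union> N (insert i X)"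
  shows "real (card A) / 2 ^ card D
    \<le> 64 * cube_avg D (\<lambda>X. of_bool (X \<in> sweep b A) * sqrt (real (card (N X))))"
proof -
  have fin: "finite A" using A(1) D by (meson finite_Pow_iff finite_subset)
  define \<theta> where "\<theta> = Max (f ` b ` A)"
  have \<theta>: "f t \<le> \<theta>" if "t \<in> b ` A" for t
    using that fin by (auto simp: \<theta>_def)
  have "\<theta> \<in> f ` b ` A" unfolding \<theta>_def using fin A(2) by (intro Max_in) auto
  then have \<theta>': "\<theta> < f s" if "s \<in> A" for s
    using gap that by auto
  \<comment> \<open>Outside the sweep, \<open>F\<close> is the indicator of the up-set generated by
    the bottoms, which creates no new violation.\<close>
  define F where "F = (\<lambda>X. if X \<in> sweep b A then \<theta> < f X else \<exists>s\<in>A. s \<subseteq> X)"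
  define M where "M = (\<lambda>X. if X \<in> sweep b A then N X else {})"
  have sub: "X \<subseteq> D" if "X \<in> sweep b A" for X using that b(2) by (auto simp: sweep_def)
  have FA: "F s" if "s \<in> A" for s
    using that le[OF that] \<theta>' by (auto simp: F_def sweep_def)
  have FB: "\<not> F t" if "t \<in> b ` A" for t
  proof -
    have "t \<in> sweep b A" using that le by (auto simp: sweep_def)
    then show ?thesis using \<theta>[OF that] by (simp add: F_def)
  qed
  have covM: "covers i (F, M)" if i: "i \<in> D" for i
    unfolding covers_def fst_conv snd_conv
  proof (intro allI impI)
    fix X assume X: "i \<notin> X" "F X" "\<not> F (insert i X)"
    \<comment> \<open>A point with value 1 lies above a bottom; hence so does the upper end, whose
      value 0 then places it in the sweep, and the lower end is caught in between.\<close>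
    have above: "\<exists>s\<in>A. s \<subseteq> X" using X(2) by (auto simp: F_def sweep_def split: if_splits)
    then have hi: "insert i X \<in> sweep b A" using X(3) by (auto simp: F_def split: if_splits)
    then have lo: "X \<in> sweep b A" using above by (auto simp: sweep_def)
    have "f (insert i X) < f X" using X hi lo by (simp add: F_def)
    then have "i \<in> N X \<union> N (insert i X)" using cov[OF i, of X] X(1) sub[OF lo] by auto
    then show "i \<in> M X \<union> M (insert i X)" using hi lo by (simp add: M_def)
  qed
  have far: "real (card A) / 2 ^ card D \<le> cube_dist D F G" if G: "\<And>i. i \<in> D \<Longrightarrow> sorted_dir i G" for G
  proof -
    have mono: "G (X \<union> Y)" if "finite Y" "Y \<subseteq> D" "G X" for X Y
      using that
    proof (induction Y rule: finite_induct)
      case (insert y Y)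
      then show ?case using G[of y] by (simp add: sorted_dir_def)
    qed simp
    have "F s \<noteq> G s \<or> F (b s) \<noteq> G (b s)" if s: "s \<in> A" for s
    proof -
      have "G s \<longrightarrow> G (s \<union> b s)" using mono[of "b s" s] b(2) s D by (auto intro: finite_subset)
      then have "G s \<longrightarrow> G (b s)" using le[OF s] by (simp add: Un_absorb1)
      then show ?thesis using FA[OF s] FB[of "b s"] s by auto
    qed
    note hit = this
    \<comment> \<open>One erroneous endpoint per pair; different pairs give different points because
      the bottoms and the tops are disjoint.\<close>
    define h where "h = (\<lambda>s. if F s \<noteq> G s then s else b s)"
    have "inj_on h A"
    proof (rule inj_onI)
      fix x y assume xy: "x \<in> A" "y \<in> A" "h x = h y"
      then have "x \<noteq> b y" "y \<noteq> b x" using b(3) by auto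
      then show "x = y" using xy inj_onD[OF b(1), of x y] by (auto simp: h_def split: if_splits)
    qed
    moreover have "h ` A \<subseteq> {X \<in> Pow D. F X \<noteq> G X}"
      using hit A(1) b(2) by (auto simp: h_def)
    ultimately have "card A \<le> card {X \<in> Pow D. F X \<noteq> G X}"
      using D by (intro card_inj_on_le) auto
    moreover have "cube_dist D F G = real (card {X \<in> Pow D. F X \<noteq> G X}) / 2 ^ card D"
      using D by (simp add: cube_dist_def cube_avg_def Int_def)
    ultimately show ?thesis by (simp add: divide_right_mono)
  qed
  have "M X \<subseteq> D" for X using N by (simp add: M_def)
  then have "real (card A) / 2 ^ card D \<le> 64 * cube_avg D (\<lambda>X. sqrt (real (card (M X))))"
    using covM far by (rule boolean_dist_le[OF D])
  also have "cube_avg D (\<lambda>X. sqrt (real (card (M X)))) = cube_avg D (\<lambda>X. of_bool (X \<in> sweep b A) * sqrt (real (card (N X))))"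
    by (intro cube_avg_cong) (simp add: M_def)
  finally show ?thesis .
qed

text \<open>The extension is the running maximum of \<open>f\<close> over the subsets outside
  \<open>C\<close>, which reproduces \<open>f\<close> there by monotonicity.\<close>

lemma ex_mono_extension:
  fixes f :: "'a set \<Rightarrow> real"
  assumes "finite D" and mono: "\<And>X Y. X \<subseteq> Y \<Longrightarrow> Y \<subseteq> D \<Longrightarrow> X \<notin> C \<Longrightarrow> Y \<notin> C \<Longrightarrow> f X \<le> f Y"
  obtains g where "\<And>X Y. X \<subseteq> Y \<Longrightarrow> Y \<subseteq> D \<Longrightarrow> g X \<le> g Y" "\<And>X. X \<subseteq> D \<Longrightarrow> X \<notin> C \<Longrightarrow> g X = f X"
proof
  \<comment> \<open>The global minimum is the default where no subset avoids \<open>C\<close>; it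
    never exceeds a value of \<open>f\<close>.\<close>
  define m where "m = Min (f ` Pow D)"
  define below where "below = (\<lambda>X. insert m (f ` {Y. Y \<subseteq> X \<and> Y \<notin> C}))"
  have fin: "finite (below X)" if "X \<subseteq> D" for X
  proof -
    have "{Y. Y \<subseteq> X \<and> Y \<notin> C} \<subseteq> Pow D" using that by auto
    then have "finite {Y. Y \<subseteq> X \<and> Y \<notin> C}"
      using assms(1) by (meson finite_Pow_iff finite_subset)
    then show ?thesis by (simp add: below_def)
  qed
  show "Max (below X) \<le> Max (below Y)" if "X \<subseteq> Y" "Y \<subseteq> D" for X Y
    using that fin[of Y] by (intro Max_mono) (auto simp: below_def)
  show "Max (below X) = f X" if "X \<subseteq> D" "X \<notin> C" for X
  proof (rule Max_eqI)
    show "finite (below X)" using that fin by simp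
    show "f X \<in> below X" using that by (simp add: below_def)
    fix y assume "y \<in> below X"
    moreover have "m \<le> f X" using that assms(1) by (simp add: m_def)
    ultimately show "y \<le> f X" using mono that by (auto simp: below_def)
  qed
qed

text \<open>Changing \<open>f\<close> on \<open>S \<union> T\<close> makes it monotone, and this set
  has twice the size of \<open>S\<close>, whence 128 = 2 * 64. The size of \<open>S\<close> is the
  sum of the cluster sizes, and disjoint sweeps let the cluster bounds add up without counting a
  label twice.\<close>

theorem dist_mono_le_labels:
  fixes f :: "'a set \<Rightarrow> real"
  assumes D: "finite D" and N: "\<And>X. N X \<subseteq> D"
    and cov: "\<And>i X. i \<in> D \<Longrightarrow> X \<subseteq> D - {i} \<Longrightarrow> f (insert i X) < f X \<Longrightarrow> i \<in> N X \<union> N (insert i X)"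
  obtains g where "\<And>X Y. X \<subseteq> Y \<Longrightarrow> Y \<subseteq> D \<Longrightarrow> g X \<le> g Y"
    "cube_avg D (\<lambda>X. of_bool (f X \<noteq> g X)) \<le> 128 * cube_avg D (\<lambda>X. sqrt (real (card (N X))))"
proof -
  obtain S T where ST: "matchable D S T"
    "\<And>S' T'. matchable D S' T' \<Longrightarrow> matching_weight f S' T' \<le> matching_weight f S T"
    "\<And>S' T'. matchable D S' T' \<Longrightarrow> matching_weight f S' T' = matching_weight f S T \<Longrightarrow> card S \<le> card S'"
    using ex_optimal_matchable[OF D, where f = f] by blast
  note exch = optimal_exchange[OF ST D]
  have sub: "S \<subseteq> Pow D" "T \<subseteq> Pow D" "S \<inter> T = {}" and "linked S T"
    using ST(1) by (auto simp: matchable_def)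
  then obtain b where b: "bij_betw b S T" "\<And>s. s \<in> S \<Longrightarrow> s \<subseteq> b s" by (auto simp: linked_def)
  have fin: "finite S" "finite T" using sub D by (auto intro: finite_subset)
  obtain \<A> where \<A>: "partition_on S \<A>" "\<And>A. A \<in> \<A> \<Longrightarrow> exchangeable b A"
    "\<And>A A'. A \<in> \<A> \<Longrightarrow> A' \<in> \<A> \<Longrightarrow> A \<noteq> A' \<Longrightarrow> sweep b A \<inter> sweep b A' = {}"
    using ex_disjoint_clusters[OF b fin(1)] by blast
  have fin\<A>: "finite \<A>" using fin(1) \<A>(1) by (rule finite_elements)
  have AS: "A \<subseteq> S" "A \<noteq> {}" if "A \<in> \<A>" for A
    using \<A>(1) that by (auto simp: partition_on_def)
  have gap: "f t < f s" if A: "A \<in> \<A>" "s \<in> A" "t \<in> b ` A" for A s t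
  proof (rule exch)
    show "s \<in> S" "t \<in> T" using A AS[OF A(1)] b(1) by (auto simp: bij_betw_def)
    have inj: "b ` A \<inter> b ` (S - A) = {}"
      using inj_on_image_Int[of b S A "S - A"] AS[OF A(1)] b(1) by (simp add: bij_betw_def)
    \<comment> \<open>The other clusters keep their matching, so an exchange within \<open>A\<close>
      is an exchange in the whole pair.\<close>
    have "linked ((A - {s}) \<union> (S - A)) ((b ` A - {t}) \<union> b ` (S - A))"
      using exchangeableD[OF \<A>(2)[OF A(1)] A(2,3)] linked_subset[OF b, of "S - A"] inj
      by (intro linked_Un) auto
    moreover have "(A - {s}) \<union> (S - A) = S - {s}" using A AS by auto
    moreover have "b ` A \<union> b ` (S - A) = T" using AS[OF A(1)] b(1) by (auto simp: bij_betw_def)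
    then have "(b ` A - {t}) \<union> b ` (S - A) = T - {t}" using A(3) inj by auto
    ultimately show "linked (S - {s}) (T - {t})" by simp
  qed
  have "real (card S) / 2 ^ card D = (\<Sum>A\<in>\<A>. real (card A) / 2 ^ card D)"
    using product_partition[OF \<A>(1)] finite_subset[OF AS(1) fin(1)]
    by (simp add: sum_divide_distrib[symmetric] flip: of_nat_sum)
  also have "\<dots> \<le> (\<Sum>A\<in>\<A>. 64 * cube_avg D (\<lambda>X. of_bool (X \<in> sweep b A) * sqrt (real (card (N X)))))"
  proof (rule sum_mono)
    fix A assume A: "A \<in> \<A>"
    have bA: "b ` A \<subseteq> T" "inj_on b A" using AS[OF A] b(1) by (auto simp: bij_betw_def intro: inj_on_subset)
    show "real (card A) / 2 ^ card D
        \<le> 64 * cube_avg D (\<lambda>X. of_bool (X \<in> sweep b A) * sqrt (real (card (N X))))"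
    proof (rule cluster_bound[OF D, where f = f])
      show "A \<subseteq> Pow D" using AS(1)[OF A] sub(1) by (rule subset_trans)
      show "b ` A \<subseteq> Pow D" using bA(1) sub(2) by (rule subset_trans)
      show "A \<inter> b ` A = {}" using AS(1)[OF A] bA(1) sub(3) by blast
      show "s \<subseteq> b s" if "s \<in> A" for s using AS(1)[OF A] that by (intro b(2)) (rule subsetD)
      show "f t < f s" if "s \<in> A" "t \<in> b ` A" for s t using A that by (rule gap)
      show "i \<in> N X \<union> N (insert i X)" if "i \<in> D" "X \<subseteq> D - {i}" "f (insert i X) < f X" for i X
        using that by (rule cov)
    qed (rule AS(2)[OF A] bA(2) N)+
  qed
  also have "\<dots> = 64 * cube_avg D (\<lambda>X. (\<Sum>A\<in>\<A>. of_bool (X \<in> sweep b A)) * sqrt (real (card (N X))))"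
    by (simp only: sum_distrib_left[symmetric] cube_avg_sum[symmetric] sum_distrib_right)
  also have "\<dots> \<le> 64 * cube_avg D (\<lambda>X. 1 * sqrt (real (card (N X))))"
  proof (intro mult_left_mono cube_avg_mono mult_right_mono)
    fix X
    have "card {A \<in> \<A>. X \<in> sweep b A} \<le> 1"
      using \<A>(3) fin\<A> by (subst card_le_Suc0_iff_eq[unfolded One_nat_def[symmetric]]) auto
    then show "(\<Sum>A\<in>\<A>. of_bool (X \<in> sweep b A)) \<le> (1::real)"
      using fin\<A> by (simp add: Int_def)
  qed auto
  finally have card_S: "real (card S) / 2 ^ card D \<le> 64 * cube_avg D (\<lambda>X. sqrt (real (card (N X))))" by simp
  \<comment> \<open>A decreasing comparable pair outside \<open>S \<union> T\<close> could be added
    to the matching, raising the maximal weight.\<close>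
  have "f X \<le> f Y" if XY: "X \<subseteq> Y" "Y \<subseteq> D" "X \<notin> S \<union> T" "Y \<notin> S \<union> T" for X Y
  proof (rule ccontr)
    assume neg: "\<not> f X \<le> f Y"
    then have "X \<noteq> Y" by auto
    then have "matchable D (insert X S) (insert Y T)"
      using XY sub linked_insert[OF \<open>linked S T\<close>, of X Y] by (auto simp: matchable_def)
    then have "matching_weight f (insert X S) (insert Y T) \<le> matching_weight f S T" by (rule ST(2))
    then show False using fin XY neg by (simp add: matching_weight_def)
  qed
  then obtain g where g: "\<And>X Y. X \<subseteq> Y \<Longrightarrow> Y \<subseteq> D \<Longrightarrow> g X \<le> g Y"
    "\<And>X. X \<subseteq> D \<Longrightarrow> X \<notin> S \<union> T \<Longrightarrow> g X = f X"
    using ex_mono_extension[OF D, of "S \<union> T" f] by blast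
  have "{X \<in> Pow D. f X \<noteq> g X} \<subseteq> S \<union> T" using g(2) by force
  then have "card {X \<in> Pow D. f X \<noteq> g X} \<le> card S + card T"
    using fin by (meson card_Un_le card_mono finite_UnI order_trans)
  also have "card T = card S" using b(1) bij_betw_same_card by metis
  finally have "real (card {X \<in> Pow D. f X \<noteq> g X}) \<le> 2 * real (card S)" by simp
  then have "cube_avg D (\<lambda>X. of_bool (f X \<noteq> g X)) \<le> 2 * (real (card S) / 2 ^ card D)"
    using D by (simp add: cube_avg_def Int_def divide_right_mono)
  also have "\<dots> \<le> 128 * cube_avg D (\<lambda>X. sqrt (real (card (N X))))" using card_S by simp
  finally show thesis using g(1) by (intro that)
qed

section \<open>Translation to the hypercube of functions\<close>

text \<open>The restricted abstraction takes the value \<open>undefined\<close> off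
  \<open>{1..d}\<close>, as extensionality of cube points demands.\<close>

definition cube_point :: "nat \<Rightarrow> nat set \<Rightarrow> point" where
  "cube_point d X = (\<lambda>i\<in>{1..d}. of_bool (i \<in> X))"

lemma bij_betw_cube_point: "bij_betw (cube_point d) (Pow {1..d}) (hypercube d)"
proof (rule bij_betwI[where g = "\<lambda>x. {i \<in> {1..d}. x i = 1}"])
  show "cube_point d \<in> Pow {1..d} \<rightarrow> hypercube d"
    by (auto simp: cube_point_def hypercube_def)
  show "(\<lambda>x. {i \<in> {1..d}. x i = 1}) \<in> hypercube d \<rightarrow> Pow {1..d}" by auto
  show "{i \<in> {1..d}. cube_point d X i = 1} = X" if "X \<in> Pow {1..d}" for X
    using that by (auto simp: cube_point_def)
  show "cube_point d {i \<in> {1..d}. x i = 1} = x" if x: "x \<in> hypercube d" for x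
  proof
    fix i
    show "cube_point d {i \<in> {1..d}. x i = 1} i = x i"
      using x by (cases "i \<in> {1..d}") (fastforce simp: cube_point_def hypercube_def PiE_iff extensional_def)+
  qed
qed

lemma card_hypercube: "card (hypercube d) = 2 ^ d"
  using bij_betw_same_card[OF bij_betw_cube_point[of d]] by (simp add: card_Pow)

lemma expectation_uniform_point:
  "measure_pmf.expectation (uniform_point d) h = cube_avg {1..d} (\<lambda>X. h (cube_point d X))"
proof -
  have "measure_pmf.expectation (uniform_point d) h = sum h (hypercube d) / 2 ^ d"
    by (simp add: uniform_point_def integral_pmf_of_set card_hypercube)
  also have "sum h (hypercube d) = (\<Sum>X\<in>Pow {1..d}. h (cube_point d X))"
    by (rule sum.reindex_bij_betw[OF bij_betw_cube_point, symmetric])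
  finally show ?thesis by (simp add: cube_avg_def)
qed

lemma prob_uniform_point:
  "measure_pmf.prob (uniform_point d) {x \<in> hypercube d. P x} = cube_avg {1..d} (\<lambda>X. of_bool (P (cube_point d X)))"
proof -
  have "measure_pmf.prob (uniform_point d) {x \<in> hypercube d. P x}
      = measure_pmf.expectation (uniform_point d) (indicator {x \<in> hypercube d. P x})" by simp
  also have "\<dots> = cube_avg {1..d} (\<lambda>X. indicator {x \<in> hypercube d. P x} (cube_point d X))"
    by (rule expectation_uniform_point)
  also have "\<dots> = cube_avg {1..d} (\<lambda>X. of_bool (P (cube_point d X)))"
    using bij_betw_cube_point[of d]
    by (intro cube_avg_cong) (auto simp: bij_betw_def indicator_def)
  finally show ?thesis .
qed

lemma cube_point_edge:
  assumes "i \<in> {1..d}" "X \<subseteq> {1..d} - {i}"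
  shows "(cube_point d X, cube_point d (insert i X)) \<in> hypercube_edges d"
proof -
  have "cube_point d Y \<in> hypercube d" for Y
    by (auto simp: cube_point_def hypercube_def)
  moreover have "\<exists>!j. j \<in> {1..d} \<and> cube_point d X j = 0 \<and> cube_point d (insert i X) j = 1
      \<and> (\<forall>k\<in>{1..d} - {j}. cube_point d X k = cube_point d (insert i X) k)"
    using assms by (intro ex1I[of _ i]) (auto simp: cube_point_def simp del: One_nat_def)
  ultimately show ?thesis by (simp add: hypercube_edges_def)
qed

lemma cube_point_insert_inj:
  assumes "X \<subseteq> {1..d}"
  shows "inj_on (\<lambda>i. cube_point d (insert i X)) ({1..d} - X)"
    "inj_on (\<lambda>i. cube_point d (X - {i})) X"
proof -
  have inj: "inj_on (cube_point d) (Pow {1..d})"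
    using bij_betw_cube_point by (rule bij_betw_imp_inj_on)
  show "inj_on (\<lambda>i. cube_point d (insert i X)) ({1..d} - X)"
  proof (rule inj_onI)
    fix i j assume ij: "i \<in> {1..d} - X" "j \<in> {1..d} - X" "cube_point d (insert i X) = cube_point d (insert j X)"
    then have "insert i X = insert j X" using inj_onD[OF inj] assms by simp
    then show "i = j" using ij by auto
  qed
  show "inj_on (\<lambda>i. cube_point d (X - {i})) X"
  proof (rule inj_onI)
    fix i j assume ij: "i \<in> X" "j \<in> X" "cube_point d (X - {i}) = cube_point d (X - {j})"
    then have "X - {i} = X - {j}" using inj_onD[OF inj, of "X - {i}" "X - {j}"] assms by auto
    then show "i = j" using ij by auto
  qed
qed

lemma finite_violated_edges: "finite (violated_edges d f)"
  by (rule finite_subset[of _ "hypercube d \<times> hypercube d"]) (auto simp: violated_edges_def hypercube_edges_def)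

text \<open>Edges are recorded by direction: red ones at their lower endpoint, blue ones at their
  upper endpoint. Together the two labels charge every violated edge.\<close>

definition red_label :: "nat \<Rightarrow> (point \<Rightarrow> real) \<Rightarrow> (point \<times> point \<Rightarrow> color) \<Rightarrow> nat set \<Rightarrow> nat set" where
  "red_label d f col X = {i \<in> {1..d} - X. X \<subseteq> {1..d} \<and>
     (cube_point d X, cube_point d (insert i X)) \<in> violated_edges d f \<and>
     col (cube_point d X, cube_point d (insert i X)) = Red}"

text \<open>Requiring \<open>X \<subseteq> {1..d}\<close> makes the label empty off the cube;
  \<open>dist_mono_le_labels\<close> asks for labels inside \<open>D\<close> at every
  argument.\<close>

definition blue_label :: "nat \<Rightarrow> (point \<Rightarrow> real) \<Rightarrow> (point \<times> point \<Rightarrow> color) \<Rightarrow> nat set \<Rightarrow> nat set" where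
  "blue_label d f col X = {i \<in> X. X \<subseteq> {1..d} \<and>
     (cube_point d (X - {i}), cube_point d X) \<in> violated_edges d f \<and>
     col (cube_point d (X - {i}), cube_point d X) = Blue}"

lemma card_red_label_le:
  assumes "X \<subseteq> {1..d}"
  shows "card (red_label d f col X) \<le> I_red d f col (cube_point d X)"
  unfolding I_red_def
proof (rule card_inj_on_le)
  show "inj_on (\<lambda>i. cube_point d (insert i X)) (red_label d f col X)"
    using cube_point_insert_inj(1)[OF assms] by (rule inj_on_subset) (auto simp: red_label_def)
  show "finite {y. (cube_point d X, y) \<in> violated_edges d f \<and> col (cube_point d X, y) = Red}"
    by (rule finite_subset[of _ "snd ` violated_edges d f"]) (force, simp add: finite_violated_edges)
qed (auto simp: red_label_def)

lemma card_blue_label_le: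
  assumes "X \<subseteq> {1..d}"
  shows "card (blue_label d f col X) \<le> I_blue d f col (cube_point d X)"
  unfolding I_blue_def
proof (rule card_inj_on_le)
  show "inj_on (\<lambda>i. cube_point d (X - {i})) (blue_label d f col X)"
    using cube_point_insert_inj(2)[OF assms] by (rule inj_on_subset) (auto simp: blue_label_def)
  show "finite {x. (x, cube_point d X) \<in> violated_edges d f \<and> col (x, cube_point d X) = Blue}"
    by (rule finite_subset[of _ "fst ` violated_edges d f"]) (force, simp add: finite_violated_edges)
qed (auto simp: blue_label_def)

text \<open>The labels are unions of red and blue ones, whose sizes are bounded by the two
  influences because distinct directions lead to distinct neighbours. Subadditivity of the square
  root separates the colors.\<close>

lemma dist_mono_le_influence:
  "dist_mono d f \<le> 128 * (measure_pmf.expectation (uniform_point d) (\<lambda>x. sqrt (real (I_red d f col x)))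
    + measure_pmf.expectation (uniform_point d) (\<lambda>y. sqrt (real (I_blue d f col y))))"
proof -
  define D where "D = {1..d}"
  define N where "N = (\<lambda>X. red_label d f col X \<union> blue_label d f col X)"
  have N: "N X \<subseteq> D" for X by (auto simp: N_def red_label_def blue_label_def D_def)
  have cov: "i \<in> N X \<union> N (insert i X)"
    if i: "i \<in> D" "X \<subseteq> D - {i}" "f (cube_point d (insert i X)) < f (cube_point d X)" for i X
  proof -
    have "(cube_point d X, cube_point d (insert i X)) \<in> violated_edges d f"
      using i cube_point_edge by (simp add: violated_edges_def D_def)
    moreover have "insert i X - {i} = X" using i by auto
    ultimately show ?thesis
      using i by (cases "col (cube_point d X, cube_point d (insert i X))")
        (auto simp: N_def red_label_def blue_label_def D_def)
  qed
  have "finite D" by (simp add: D_def)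
  then obtain g where g: "\<And>X Y. X \<subseteq> Y \<Longrightarrow> Y \<subseteq> D \<Longrightarrow> g X \<le> g Y"
    "cube_avg D (\<lambda>X. of_bool (f (cube_point d X) \<noteq> g X)) \<le> 128 * cube_avg D (\<lambda>X. sqrt (real (card (N X))))"
    using dist_mono_le_labels[of D N "\<lambda>X. f (cube_point d X)"] N cov by blast
  \<comment> \<open>A 0/1 vector is read back as the set of its ones, so that \<open>g\<close>
    becomes a competitor in \<open>dist_mono\<close>.\<close>
  define h where "h = (\<lambda>x :: point. g {i \<in> D. x i = 1})"
  have "mono_on (hypercube d) h"
  proof (rule mono_onI)
    fix x y assume xy: "x \<in> hypercube d" "y \<in> hypercube d" "x \<le> y"
    have "{i \<in> D. x i = 1} \<subseteq> {i \<in> D. y i = 1}"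
    proof safe
      fix i assume "i \<in> D" "x i = 1"
      moreover from this have "y i \<in> {0, 1}" using xy(2) by (auto simp: hypercube_def D_def)
      moreover have "x i \<le> y i" using xy(3) by (simp add: le_fun_def)
      ultimately show "y i = 1" by auto
    qed
    then show "h x \<le> h y" unfolding h_def by (intro g(1)) auto
  qed
  then have "dist_mono d f \<le> measure_pmf.prob (uniform_point d) {x \<in> hypercube d. f x \<noteq> h x}"
    unfolding dist_mono_def by (intro Min_le dist_mono_values) auto
  also have "\<dots> = cube_avg D (\<lambda>X. of_bool (f (cube_point d X) \<noteq> h (cube_point d X)))"
    unfolding D_def by (rule prob_uniform_point)
  also have "\<dots> = cube_avg D (\<lambda>X. of_bool (f (cube_point d X) \<noteq> g X))"
  proof (rule cube_avg_cong)
    fix X assume "X \<subseteq> D"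
    then have "{i \<in> D. cube_point d X i = 1} = X" by (auto simp: cube_point_def D_def)
    then show "of_bool (f (cube_point d X) \<noteq> h (cube_point d X)) = (of_bool (f (cube_point d X) \<noteq> g X) :: real)"
      by (simp add: h_def)
  qed
  also note g(2)
  also have "cube_avg D (\<lambda>X. sqrt (real (card (N X))))
      \<le> cube_avg D (\<lambda>X. sqrt (real (I_red d f col (cube_point d X))) + sqrt (real (I_blue d f col (cube_point d X))))"
  proof (rule cube_avg_mono)
    fix X assume X: "X \<subseteq> D"
    have "card (N X) \<le> I_red d f col (cube_point d X) + I_blue d f col (cube_point d X)"
      using card_Un_le[of "red_label d f col X" "blue_label d f col X"]
        card_red_label_le[of X d f col] card_blue_label_le[of X d f col] X
      by (simp add: N_def D_def)
    then have "sqrt (real (card (N X))) \<le> sqrt (real (I_red d f col (cube_point d X)) + real (I_blue d f col (cube_point d X)))"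
      by (simp flip: of_nat_add)
    also have "\<dots> \<le> sqrt (real (I_red d f col (cube_point d X))) + sqrt (real (I_blue d f col (cube_point d X)))"
      by (intro sqrt_add_le_add_sqrt) auto
    finally show "sqrt (real (card (N X)))
        \<le> sqrt (real (I_red d f col (cube_point d X))) + sqrt (real (I_blue d f col (cube_point d X)))" .
  qed
  finally show ?thesis
    by (simp add: cube_avg_add D_def expectation_uniform_point)
qed

theorem theorem1p2:
  shows "\<exists>C::real. C > 0 \<and>
    (\<forall>d\<ge>1. \<forall>(f :: point \<Rightarrow> real) (col :: point \<times> point \<Rightarrow> color).
       measure_pmf.expectation (uniform_point d) (\<lambda>x. sqrt (real (I_red d f col x)))
       + measure_pmf.expectation (uniform_point d) (\<lambda>y. sqrt (real (I_blue d f col y)))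
       \<ge> C * dist_mono d f)"
proof (intro exI[of _ "1 / 128"] conjI allI impI)
  fix d f col
  show "1 / 128 * dist_mono d f
      \<le> measure_pmf.expectation (uniform_point d) (\<lambda>x. sqrt (real (I_red d f col x)))
       + measure_pmf.expectation (uniform_point d) (\<lambda>y. sqrt (real (I_blue d f col y)))"
    using dist_mono_le_influence[of d f col] by simp
qed simp

end
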